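(* Let $\Phi$ be a convex subset of a Euclidean space endowed with the norm $\|\cdot\|$, let $\{M_n(\phi),\ \phi\in\Phi\}$ be a sequence of real-valued processes such that $M_n$ is almost surely a convex function on $\Phi$, let $\beta\in\Phi$, let $V\subseteq\Phi$ be a neighborhood of $\beta$ and let $\Delta$ be a strictly convex real-valued function defined on $V$ such that: for any $\phi\in V$, $M_n(\phi)\to\Delta(\phi)$ in probability; and $\Delta(\phi)\ge\Delta(\beta)$ for all $\phi\in V$. Let $(J_n)$ be a sequence of non-negative functions defined on $\Phi$ such that $J_n(\beta)\to0$, and define $\Lambda_n(\phi,t)=M_n(\phi)+t\,J_n(\phi)$ for $\phi\in\Phi$, $t\ge0$. Then the three following assertions hold. (a) For any $L\ge0$, if $\{\widehat\beta_n(t),\ t\ge0\}$ are $\Phi$-valued processes satisfying $$\sup_{t\in[0,L]}\{\Lambda_n(\widehat\beta_n(t),t)-\Lambda_n(\beta,t)\}_+\to0\quad\text{in }P^*\text{-probability},\qquad(1)$$ then $\widehat\beta_n(t)$ converges to $\beta$ uniformly in $t\in[0,L]$, in $P^*$-probability, that is, $\sup_{t\in[0,L]}\|\widehat\beta_n(t)-\beta\|\to0$ in $P^*$-probability. (b) If $J_n$ is strictly convex on $\Phi$, then it is always possible to define a deterministic non-negative sequence $(L_n)$ with $L_n\to\infty$, a sequence $(A_n)$ of events in $\mathcal F$ with $P(A_n)\to1$, and, for each $n$, a collection $\{\widehat\beta_n(t),\ t\ge0\}$ of random variables satisfying the two following properties. (b1) For all $t\in[0,L_n]$ and $\omega\in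 A_n$, $\Lambda_n(\widehat\beta_n(\omega,t),t)$ is a minimum of $\Lambda_n(\phi,t)$ on $\phi\in\Phi$, and this minimum is unique for $t>0$. (b2) For all $\omega\in\Omega$, $\widehat\beta_n(\omega,\cdot)$ is a continuous function on $(0,L_n]$ and on $(L_n,\infty)$. As consequences, (1) holds for any $L>0$ and the uniform convergence holds in $P$-probability, that is, $\sup_{t\in[0,L]}\|\widehat\beta_n(t)-\beta\|\to0$ in probability. (c) If $M_n$ is strictly convex on $\Phi$ for all $n$, then the conclusions of (b) hold with properties (b1) and (b2) strengthened as follows. (c1) For all $t\in[0,L_n]$ and $\omega\in A_n$, $\Lambda_n(\widehat\beta_n(\omega,t),t)$ is the unique minimum of $\Lambda_n(\phi,t)$ on $\phi\in\Phi$. (c2) For all $\omega\in\Omega$, $\widehat\beta_n(\omega,\cdot)$ is a continuous function on $[0,L_n]$ and on $(L_n,\infty)$.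
   Context: All processes are defined on a probability space $(\Omega,\mathcal F,P)$; the functions $J_n$ are deterministic. $a_+=\max(0,a)$. For $A\subseteq\Omega$, the outer probability is $P^*(A)=\inf\{P(B):B\in\mathcal F,\ A\subset B\}$. A sequence $(Y_n)$ of real-valued (not necessarily measurable) maps on $\Omega$ converges to $0$ in $P^*$-probability if $P^*(|Y_n|\ge\epsilon)\to0$ for every $\epsilon>0$. Uniqueness of the minimum in (b1) and (c1) refers to uniqueness of the minimizing point.
   Formalization: In (c) each J_n is additionally assumed convex on Φ; without this (c) fails, e.g. M_n = x², β = 0 and J_n = 1/n at 0 and 0 elsewhere on the real line, where no minimum exists for t > 0. *)

theory Defs
  imports "HOL-Probability.Probability"
begin

(* Strict convexity is tested on the segments contained in S. If S is convex these are all
   segments between points of S. The form with the segment condition is used because the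
   neighbourhood on which the limit function lives need not be convex. *)
definition strictly_convex_on :: "'a::real_vector set \<Rightarrow> ('a \<Rightarrow> real) \<Rightarrow> bool" where
  "strictly_convex_on S f \<longleftrightarrow>
     (\<forall>x y u. x \<noteq> y \<and> closed_segment x y \<subseteq> S \<and> 0 < u \<and> u < 1 \<longrightarrow>
        f ((1 - u) *\<^sub>R x + u *\<^sub>R y) < (1 - u) * f x + u * f y)"

lemma strictly_convex_on_convex_iff:
  assumes "convex S"
  shows "strictly_convex_on S f \<longleftrightarrow>
     (\<forall>x\<in>S. \<forall>y\<in>S. \<forall>u. x \<noteq> y \<and> 0 < u \<and> u < 1 \<longrightarrow>
        f ((1 - u) *\<^sub>R x + u *\<^sub>R y) < (1 - u) * f x + u * f y)"
proof -
  have "closed_segment x y \<subseteq> S \<longleftrightarrow> x \<in> S \<and> y \<in> S" for x y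
    using assms by (auto dest: closed_segment_subset[of x S y])
  then show ?thesis
    unfolding strictly_convex_on_def by blast
qed

(* Suprema over uncountable index sets may be infinite and need not be measurable, so the
   sequences below are ereal-valued and P^* is the library's outer_measure_of. *)
definition tendsto_zero_outer_prob :: "'w measure \<Rightarrow> (nat \<Rightarrow> 'w \<Rightarrow> ereal) \<Rightarrow> bool" where
  "tendsto_zero_outer_prob P Y \<longleftrightarrow>
     (\<forall>\<epsilon>::real. \<epsilon> > 0 \<longrightarrow>
        (\<lambda>n. outer_measure_of P {\<omega> \<in> space P. ereal \<epsilon> \<le> \<bar>Y n \<omega>\<bar>}) \<longlonglongrightarrow> 0)"

(* Measurability is part of the notion: measure returns 0 on non-measurable sets. *)
definition tendsto_zero_prob :: "'w measure \<Rightarrow> (nat \<Rightarrow> 'w \<Rightarrow> ereal) \<Rightarrow> bool" where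
  "tendsto_zero_prob P Y \<longleftrightarrow>
     (\<forall>n. Y n \<in> borel_measurable P) \<and>
     (\<forall>\<epsilon>::real. \<epsilon> > 0 \<longrightarrow>
        (\<lambda>n. measure P {\<omega> \<in> space P. ereal \<epsilon> \<le> \<bar>Y n \<omega>\<bar>}) \<longlonglongrightarrow> 0)"

definition penalized ::
  "(nat \<Rightarrow> 'a \<Rightarrow> 'w \<Rightarrow> real) \<Rightarrow> (nat \<Rightarrow> 'a \<Rightarrow> real) \<Rightarrow> nat \<Rightarrow> 'a \<Rightarrow> real \<Rightarrow> 'w \<Rightarrow> real" where
  "penalized M J n \<phi> t \<omega> = M n \<phi> \<omega> + t * J n \<phi>"

definition valued_processes ::
  "'w measure \<Rightarrow> 'a::euclidean_space set \<Rightarrow> (nat \<Rightarrow> real \<Rightarrow> 'w \<Rightarrow> 'a) \<Rightarrow> bool" where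
  "valued_processes P \<Phi> b \<longleftrightarrow>
     (\<forall>n. \<forall>t\<ge>0. b n t \<in> borel_measurable P \<and> (\<forall>\<omega>\<in>space P. b n t \<omega> \<in> \<Phi>))"

definition near_minimizing ::
  "'w measure \<Rightarrow> (nat \<Rightarrow> 'a \<Rightarrow> 'w \<Rightarrow> real) \<Rightarrow> (nat \<Rightarrow> 'a \<Rightarrow> real) \<Rightarrow> 'a \<Rightarrow> real \<Rightarrow>
    (nat \<Rightarrow> real \<Rightarrow> 'w \<Rightarrow> 'a) \<Rightarrow> bool" where
  "near_minimizing P M J \<beta> L b \<longleftrightarrow>
     tendsto_zero_outer_prob P
       (\<lambda>n \<omega>. SUP t\<in>{0..L}.
          ereal (max 0 (penalized M J n (b n t \<omega>) t \<omega> - penalized M J n \<beta> t \<omega>)))"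

definition sup_dist :: "'a::real_normed_vector \<Rightarrow> real \<Rightarrow> (nat \<Rightarrow> real \<Rightarrow> 'w \<Rightarrow> 'a) \<Rightarrow>
    nat \<Rightarrow> 'w \<Rightarrow> ereal" where
  "sup_dist \<beta> L b n \<omega> = (SUP t\<in>{0..L}. ereal (norm (b n t \<omega> - \<beta>)))"

(* Data common to both existence claims: horizons Ls, events A, and processes b. *)
definition admissible ::
  "'w measure \<Rightarrow> 'a::euclidean_space set \<Rightarrow> (nat \<Rightarrow> real) \<Rightarrow> (nat \<Rightarrow> 'w set) \<Rightarrow>
    (nat \<Rightarrow> real \<Rightarrow> 'w \<Rightarrow> 'a) \<Rightarrow> bool" where
  "admissible P \<Phi> Ls A b \<longleftrightarrow>
     (\<forall>n. 0 \<le> Ls n) \<and> filterlim Ls at_top sequentially \<and>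
     (\<forall>n. A n \<in> sets P) \<and> (\<lambda>n. measure P (A n)) \<longlonglongrightarrow> 1 \<and>
     valued_processes P \<Phi> b"

definition is_unique_arg_min :: "('a \<Rightarrow> real) \<Rightarrow> ('a \<Rightarrow> bool) \<Rightarrow> 'a \<Rightarrow> bool" where
  "is_unique_arg_min f Q x \<longleftrightarrow> is_arg_min f Q x \<and> (\<forall>y. is_arg_min f Q y \<longrightarrow> y = x)"

end

theory Submission
  imports Defs
begin

text \<open>
  The engine is a deterministic fact about convex functions. Let \<open>r\<close> be small. The strictly convex
  limit \<open>\<Delta>\<close> exceeds \<open>\<Delta> \<beta>\<close> by a fixed amount on the sphere of radius \<open>r\<close> about \<open>\<beta>\<close>. If a convex
  function is close to \<open>\<Delta>\<close> at the points of a suitable finite set, then it has a fixed gap on that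
  sphere as well (\<open>uniform_growth_on_sphere\<close>). Only finitely many points matter, so pointwise
  convergence in probability suffices: with probability tending to one, \<open>M n\<close> is at least
  \<open>M n \<beta> + \<eta>\<close> on the whole sphere (\<open>growth_events\<close>).

  For near minimizers, \<open>J n \<ge> 0\<close> gives
  \<open>M n (b n t) \<le> M n \<beta> + t * J n \<beta> + o(1)\<close> uniformly for \<open>t\<close> in \<open>{0..L}\<close>, and \<open>L * J n \<beta>\<close> tends to
  zero, so eventually \<open>M n (b n t) < M n \<beta> + \<eta>\<close>. A convex function with the gap \<open>\<eta>\<close> on the sphere
  is that small only inside the ball (\<open>sublevel_within_sphere\<close>); hence \<open>near_minimizers_converge\<close>.

  For existence, horizons \<open>Ls n\<close> are chosen with \<open>Ls n * J n \<beta>\<close> tending to zero. For \<open>t\<close> up to \<open>Ls n\<close>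
  the penalized function then keeps a positive gap on the sphere, so a minimizer over the compact
  ball is a global one (\<open>minimizer_on_cball_is_arg_min\<close>). At \<open>t = 0\<close> there may be many minimizers
  when only the penalty is strictly convex; among them the one with the smallest penalty is
  selected. This choice is the limit of the minimizers for \<open>t\<close> decreasing to zero, so the selected
  path is continuous on all of \<open>{0..}\<close> (\<open>continuous_on_penalty_path\<close>), and its value at zero is
  measurable as a limit of unique, hence measurable, minimizers (\<open>measurable_penalty_path\<close>). Exact
  minimizers are near minimizers, and continuity in \<open>t\<close> makes the supremum of the distances
  measurable, which turns convergence in outer probability into convergence in probability.
\<close>

section \<open>Strict convexity\<close>

lemma strictly_convex_onD:
  assumes "strictly_convex_on S f" "convex S" "x \<in> S" "y \<in> S" "x \<noteq> y" "0 < u" "u < 1"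
  shows "f ((1 - u) *\<^sub>R x + u *\<^sub>R y) < (1 - u) * f x + u * f y"
  using assms by (auto simp: strictly_convex_on_convex_iff)

lemma strictly_convex_on_subset:
  assumes "strictly_convex_on T f" "S \<subseteq> T"
  shows "strictly_convex_on S f"
  using assms unfolding strictly_convex_on_def by blast

lemma strictly_convex_on_imp_convex_on:
  assumes "strictly_convex_on S f" "convex S"
  shows "convex_on S f"
proof (rule convex_onI[OF _ \<open>convex S\<close>])
  fix t :: real and x y
  assume "0 < t" "t < 1" "x \<in> S" "y \<in> S"
  then show "f ((1 - t) *\<^sub>R x + t *\<^sub>R y) \<le> (1 - t) * f x + t * f y"
    using strictly_convex_onD[OF assms, of x y t]
    by (cases "x = y") (auto simp: algebra_simps simp flip: scaleR_add_left)
qed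

lemma strictly_convex_on_add_scaled:
  assumes "convex S" "convex_on S m" "convex_on S j" "0 \<le> t"
    and strict: "strictly_convex_on S m \<or> 0 < t \<and> strictly_convex_on S j"
  shows "strictly_convex_on S (\<lambda>x. m x + t * j x)"
  unfolding strictly_convex_on_convex_iff[OF \<open>convex S\<close>]
proof (intro ballI allI impI, elim conjE)
  fix x y and u :: real
  assume xy: "x \<in> S" "y \<in> S" "x \<noteq> y" and u: "0 < u" "u < 1"
  let ?z = "(1 - u) *\<^sub>R x + u *\<^sub>R y"
  have m: "m ?z \<le> (1 - u) * m x + u * m y" and j: "j ?z \<le> (1 - u) * j x + u * j y"
    using convex_onD[OF assms(2)] convex_onD[OF assms(3)] xy u by auto
  have "t * j ?z \<le> t * ((1 - u) * j x + u * j y)"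
    using j \<open>0 \<le> t\<close> by (rule mult_left_mono)
  moreover have "m ?z < (1 - u) * m x + u * m y \<or> t * j ?z < t * ((1 - u) * j x + u * j y)"
    using strict strictly_convex_onD[OF _ \<open>convex S\<close> xy u] by auto
  ultimately show "m ?z + t * j ?z < (1 - u) * (m x + t * j x) + u * (m y + t * j y)"
    using m by (auto simp: algebra_simps)
qed

lemma strictly_convex_on_minimizer_unique:
  fixes f :: "'a::real_vector \<Rightarrow> real"
  assumes "strictly_convex_on S f" "convex S"
    and "x \<in> S" "\<And>z. z \<in> S \<Longrightarrow> f x \<le> f z"
    and "y \<in> S" "\<And>z. z \<in> S \<Longrightarrow> f y \<le> f z"
  shows "x = y"
proof (rule ccontr)
  assume "x \<noteq> y"
  then have "f ((1 - 1/2) *\<^sub>R x + (1/2) *\<^sub>R y) < (1 - 1/2) * f x + (1/2) * f y"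
    using assms by (intro strictly_convex_onD) auto
  moreover have "(1 - 1/2) *\<^sub>R x + (1/2) *\<^sub>R y \<in> S"
    using assms by (intro convexD_alt) auto
  ultimately show False
    using assms(4)[of "(1 - 1/2) *\<^sub>R x + (1/2) *\<^sub>R y"] assms(4)[of y] assms(6)[of x] assms(3,5) by auto
qed

lemma strictly_convex_on_is_unique_arg_min:
  assumes "strictly_convex_on S f" "convex S" "is_arg_min f (\<lambda>x. x \<in> S) x"
  shows "is_unique_arg_min f (\<lambda>x. x \<in> S) x"
  using assms(3) strictly_convex_on_minimizer_unique[OF assms(1,2)]
  unfolding is_unique_arg_min_def is_arg_min_linorder by blast

section \<open>Convex functions with a gap on a sphere\<close>

text \<open>
  The segment from \<open>\<beta>\<close> to a point outside the ball crosses the sphere, and there convexity would give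
  a value below \<open>f \<beta> + \<eta>\<close>.
\<close>

lemma sublevel_within_sphere:
  fixes f :: "'a::real_normed_vector \<Rightarrow> real"
  assumes "convex_on S f" "\<beta> \<in> S" "0 < r" "0 < \<eta>"
    and sphere: "\<And>s. s \<in> sphere \<beta> r \<Longrightarrow> f \<beta> + \<eta> \<le> f s"
    and "x \<in> S" "f x < f \<beta> + \<eta>"
  shows "norm (x - \<beta>) < r"
proof (rule ccontr)
  assume "\<not> norm (x - \<beta>) < r"
  define u where "u = r / norm (x - \<beta>)"
  have u: "0 < u" "u \<le> 1"
    using \<open>\<not> norm (x - \<beta>) < r\<close> \<open>0 < r\<close> unfolding u_def by (auto simp: divide_simps)
  have "(1 - u) *\<^sub>R \<beta> + u *\<^sub>R x - \<beta> = u *\<^sub>R (x - \<beta>)"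
    by (simp add: algebra_simps)
  then have "(1 - u) *\<^sub>R \<beta> + u *\<^sub>R x \<in> sphere \<beta> r"
    using \<open>\<not> norm (x - \<beta>) < r\<close> \<open>0 < r\<close> unfolding u_def
    by (subst sphere_def) (auto simp: dist_norm norm_minus_commute)
  then have "f \<beta> + \<eta> \<le> f ((1 - u) *\<^sub>R \<beta> + u *\<^sub>R x)"
    by (rule sphere)
  also have "\<dots> \<le> (1 - u) * f \<beta> + u * f x"
    using u assms by (intro convex_onD[OF assms(1)]) auto
  also have "\<dots> < (1 - u) * f \<beta> + u * (f \<beta> + \<eta>)"
    using u assms by simp
  also have "\<dots> \<le> f \<beta> + \<eta>"
    using u \<open>0 < \<eta>\<close> mult_right_mono[of u 1 \<eta>] by (simp add: algebra_simps)
  finally show False by simp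
qed

text \<open>
  A point of \<open>S\<close> with a smaller value would lie in a sublevel set below \<open>f \<beta> + \<eta>\<close>, hence inside the
  ball, where \<open>x\<close> is already minimal.
\<close>

lemma minimizer_on_cball_is_arg_min:
  fixes f :: "'a::real_normed_vector \<Rightarrow> real"
  assumes "convex_on S f" "0 < r" "cball \<beta> r \<subseteq> S" "0 < \<eta>"
    and sphere: "\<And>s. s \<in> sphere \<beta> r \<Longrightarrow> f \<beta> + \<eta> \<le> f s"
    and "x \<in> cball \<beta> r" and min: "\<And>y. y \<in> cball \<beta> r \<Longrightarrow> f x \<le> f y"
  shows "is_arg_min f (\<lambda>x. x \<in> S) x"
  unfolding is_arg_min_linorder
proof (intro conjI allI impI)
  have "\<beta> \<in> cball \<beta> r" using \<open>0 < r\<close> by simp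
  fix y assume "y \<in> S"
  show "f x \<le> f y"
  proof (rule ccontr)
    assume "\<not> f x \<le> f y"
    then have "f y < f \<beta> + \<eta>"
      using min[OF \<open>\<beta> \<in> cball \<beta> r\<close>] \<open>0 < \<eta>\<close> by simp
    then have "norm (y - \<beta>) < r"
      using \<open>\<beta> \<in> cball \<beta> r\<close> assms \<open>y \<in> S\<close> by (intro sublevel_within_sphere[of S f \<beta> r \<eta>]) auto
    then show False
      using min[of y] \<open>\<not> f x \<le> f y\<close> by (auto simp: dist_norm norm_minus_commute)
  qed
qed (use assms in auto)

text \<open>
  The quantitative form of "pointwise convergence of convex functions is locally uniform": the set
  \<open>F\<close> and the tolerance \<open>\<delta>\<close> do not depend on \<open>f\<close>, so that the bound transfers directly to
  convergence in probability. The set \<open>F\<close> consists of \<open>\<beta>\<close>, the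
  vertices of a box about \<open>\<beta>\<close>, where closeness to \<open>\<Delta>\<close> bounds \<open>f - f \<beta>\<close> above on the whole box, and
  a fine net of the sphere. If \<open>f\<close> were small at a point \<open>s\<close> of the sphere, then convexity on a
  segment from \<open>s\<close> through a nearby net point \<open>x\<close> to a point \<open>z\<close> of the box, where \<open>f\<close> is bounded
  above, would make \<open>f x\<close> too small.
\<close>

lemma uniform_growth_on_sphere:
  fixes \<Delta> :: "'a::euclidean_space \<Rightarrow> real"
  assumes "open U" "\<beta> \<in> U" "convex_on U \<Delta>"
    and strict: "\<And>x. x \<in> U \<Longrightarrow> x \<noteq> \<beta> \<Longrightarrow> \<Delta> \<beta> < \<Delta> x"
  shows "\<exists>\<rho>>0. ball \<beta> \<rho> \<subseteq> U \<and>
    (\<forall>r. 0 < r \<and> r < \<rho> \<longrightarrow> (\<exists>F \<delta> \<eta>. finite F \<and> F \<subseteq> U \<and> 0 < \<delta> \<and> 0 < \<eta> \<and>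
       (\<forall>f. convex_on U f \<longrightarrow> (\<forall>x\<in>F. \<bar>f x - \<Delta> x\<bar> < \<delta>) \<longrightarrow> (\<forall>s\<in>sphere \<beta> r. f \<beta> + \<eta> \<le> f s))))"
proof -
  obtain a b where ab: "cbox a b \<subseteq> U" "\<beta> \<in> box a b"
    using open_contains_cbox[OF assms(1,2)] by metis
  obtain \<rho> where \<rho>: "0 < \<rho>" "ball \<beta> \<rho> \<subseteq> box a b"
    using open_contains_ball[of "box a b"] ab(2) open_box by blast
  obtain S where S: "finite S" "cbox a b = convex hull S"
    using closed_interval_as_convex_hull[of a b] by metis
  have ball_cbox: "ball \<beta> \<rho> \<subseteq> cbox a b"
    using \<rho>(2) box_subset_cbox by blast
  have SU: "S \<subseteq> U"
    using S(2) ab(1) hull_subset[of S convex] by auto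
  show ?thesis
  proof (rule exI[of _ \<rho>], intro conjI allI impI \<rho>(1); (elim conjE)?)
    show "ball \<beta> \<rho> \<subseteq> U"
      using ball_cbox ab(1) by blast
    fix r :: real assume r: "0 < r" "r < \<rho>"
    have sphere_ball: "sphere \<beta> r \<subseteq> ball \<beta> \<rho>"
      using r by auto
    then have sphere_U: "sphere \<beta> r \<subseteq> U"
      using ball_cbox ab(1) by blast
    have "continuous_on (sphere \<beta> r) \<Delta>"
      using convex_on_continuous[OF assms(1,3)] sphere_U continuous_on_subset by blast
    have "\<exists>m>0. \<forall>s\<in>sphere \<beta> r. \<Delta> \<beta> + m \<le> \<Delta> s"
    proof (cases "sphere \<beta> r = {}")
      case False
      then obtain s0 where s0: "s0 \<in> sphere \<beta> r" "\<And>s. s \<in> sphere \<beta> r \<Longrightarrow> \<Delta> s0 \<le> \<Delta> s"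
        using continuous_attains_inf[OF compact_sphere False \<open>continuous_on _ \<Delta>\<close>] by blast
      then have "\<Delta> \<beta> < \<Delta> s0"
        using r sphere_U by (intro strict) auto
      with s0 show ?thesis
        by (intro exI[of _ "\<Delta> s0 - \<Delta> \<beta>"]) auto
    qed (auto intro: exI[of _ 1])
    then obtain m where m: "0 < m" "\<And>s. s \<in> sphere \<beta> r \<Longrightarrow> \<Delta> \<beta> + m \<le> \<Delta> s"
      by blast
    \<comment> \<open>\<open>C\<close> bounds \<open>f - f \<beta>\<close> on the box, \<open>2\<close> absorbing the two errors \<open>\<delta> \<le> 1\<close>; moving by the fraction
       \<open>u\<close> of a segment ending in the box then costs at most \<open>m / 4\<close> of the gap \<open>m\<close>.\<close>
    define C where "C = 2 + (\<Sum>x\<in>S. \<bar>\<Delta> x - \<Delta> \<beta>\<bar>)"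
    define u where "u = min (1/2) (m / (4 * C))"
    define \<delta> where "\<delta> = min 1 (m / 8)"
    have C: "2 \<le> C"
      unfolding C_def by (simp add: sum_nonneg)
    have u: "0 < u" "u < 1" "u * C \<le> m / 4"
      using C m(1) unfolding u_def by (auto simp: min_def field_simps)
    have \<delta>: "0 < \<delta>" "\<delta> \<le> 1" "\<delta> \<le> m / 8"
      using m(1) unfolding \<delta>_def by auto
    have "0 < u * (\<rho> - r)"
      using u r by simp
    then obtain N where N: "finite N" "N \<subseteq> sphere \<beta> r" "sphere \<beta> r \<subseteq> (\<Union>x\<in>N. ball x (u * (\<rho> - r)))"
      using compactE_image[OF compact_sphere[of \<beta> r], of "sphere \<beta> r" "\<lambda>x. ball x (u * (\<rho> - r))"]
      by force
    have "f \<beta> + m / 2 \<le> f s"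
      if f: "convex_on U f" "\<forall>x\<in>{\<beta>} \<union> S \<union> N. \<bar>f x - \<Delta> x\<bar> < \<delta>" and s: "s \<in> sphere \<beta> r" for f s
    proof -
      have "f x \<le> f \<beta> + C" if "x \<in> cbox a b" for x
      proof -
        have "f x \<le> f \<beta> + C" if "x \<in> S" for x
        proof -
          have "\<bar>\<Delta> x - \<Delta> \<beta>\<bar> \<le> (\<Sum>x\<in>S. \<bar>\<Delta> x - \<Delta> \<beta>\<bar>)"
            using member_le_sum[of x S "\<lambda>x. \<bar>\<Delta> x - \<Delta> \<beta>\<bar>"] S(1) that by auto
          moreover have "\<bar>f x - \<Delta> x\<bar> < \<delta>" "\<bar>f \<beta> - \<Delta> \<beta>\<bar> < \<delta>"
            using f(2) that by auto
          ultimately show ?thesis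
            using \<delta>(2) unfolding C_def by linarith
        qed
        moreover have "convex_on (convex hull S) f"
          using f(1) S(2) ab(1) by (metis convex_on_subset convex_convex_hull)
        ultimately show ?thesis
          using convex_on_convex_hull_bound[of S f "f \<beta> + C"] that S(2) by blast
      qed
      note upper = this
      obtain x where x: "x \<in> N" "dist x s < u * (\<rho> - r)"
        using N(3) s by auto
      \<comment> \<open>The net point \<open>x\<close> lies at the fraction \<open>u\<close> of the segment from \<open>s\<close> to \<open>z\<close>.\<close>
      define z where "z = s + (1 / u) *\<^sub>R (x - s)"
      have "norm ((1 / u) *\<^sub>R (x - s)) < \<rho> - r"
      proof -
      have "norm ((1 / u) *\<^sub>R (x - s)) = norm (x - s) / u"
        using u by simp
      then show ?thesis
        using x(2) u by (simp add: dist_norm divide_less_eq mult.commute)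
    qed
      then have "norm (z - \<beta>) < \<rho>"
        using s norm_triangle_ineq[of "s - \<beta>" "(1 / u) *\<^sub>R (x - s)"]
        unfolding z_def by (simp add: dist_norm norm_minus_commute algebra_simps)
      then have z: "z \<in> cbox a b"
        using ball_cbox by (auto simp: dist_norm norm_minus_commute)
      have "x = (1 - u) *\<^sub>R s + u *\<^sub>R z"
        using u unfolding z_def by (simp add: algebra_simps)
      then have "f x \<le> (1 - u) * f s + u * f z"
        using convex_onD[OF f(1), of u s z] u subsetD[OF sphere_U s] subsetD[OF ab(1) z] by simp
      also have "\<dots> \<le> (1 - u) * f s + u * (f \<beta> + C)"
        using upper[OF z] u by simp
      finally have "f x \<le> (1 - u) * f s + u * (f \<beta> + C)" .
      moreover have "f \<beta> + 3 * m / 4 \<le> f x"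
      proof -
        have "\<bar>f x - \<Delta> x\<bar> < \<delta>" "\<bar>f \<beta> - \<Delta> \<beta>\<bar> < \<delta>"
          using f(2) x(1) by auto
        then show ?thesis
          using m(2)[of x] x(1) N(2) \<delta>(3) by auto
      qed
      ultimately have "m / 2 \<le> (1 - u) * (f s - f \<beta>)"
        using u(3) by (simp add: algebra_simps)
      moreover have "(1 - u) * (f s - f \<beta>) \<le> f s - f \<beta>"
      proof -
        have "0 < f s - f \<beta>"
          using \<open>m / 2 \<le> (1 - u) * (f s - f \<beta>)\<close> m(1) u zero_less_mult_pos[of "1 - u" "f s - f \<beta>"]
          by linarith
        then show ?thesis
          using u by (simp add: mult_left_le_one_le)
      qed
      ultimately show ?thesis by simp
    qed
    then show "\<exists>F \<delta> \<eta>. finite F \<and> F \<subseteq> U \<and> 0 < \<delta> \<and> 0 < \<eta> \<and>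
       (\<forall>f. convex_on U f \<longrightarrow> (\<forall>x\<in>F. \<bar>f x - \<Delta> x\<bar> < \<delta>) \<longrightarrow> (\<forall>s\<in>sphere \<beta> r. f \<beta> + \<eta> \<le> f s))"
      using S(1) N(1,2) SU sphere_U assms(2) \<delta>(1) m(1)
      by (intro exI[of _ "{\<beta>} \<union> S \<union> N"] exI[of _ \<delta>] exI[of _ "m / 2"]) auto
  qed
qed

section \<open>Measurability of unique minimizers\<close>

text \<open>
  By compactness and uniqueness, the minimizer lies in a relatively closed subset of \<open>K\<close> iff the
  infimum over that subset equals the infimum over \<open>K\<close>. Continuity lets both infima run over
  countable dense sets, which makes this a countable combination of measurable events.
\<close>

lemma measurable_unique_minimizer:
  fixes h :: "'a::euclidean_space \<Rightarrow> 'w \<Rightarrow> real"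
  assumes K: "compact K"
    and h: "\<And>x. x \<in> K \<Longrightarrow> h x \<in> borel_measurable N"
    and cont: "\<And>\<omega>. \<omega> \<in> space N \<Longrightarrow> continuous_on K (\<lambda>x. h x \<omega>)"
    and b: "\<And>\<omega>. \<omega> \<in> space N \<Longrightarrow> b \<omega> \<in> K"
    and min: "\<And>\<omega> y. \<omega> \<in> space N \<Longrightarrow> y \<in> K \<Longrightarrow> h (b \<omega>) \<omega> \<le> h y \<omega>"
    and uniq: "\<And>\<omega> x. \<omega> \<in> space N \<Longrightarrow> x \<in> K \<Longrightarrow> (\<And>y. y \<in> K \<Longrightarrow> h x \<omega> \<le> h y \<omega>) \<Longrightarrow> x = b \<omega>"
  shows "b \<in> borel_measurable N"
proof (rule borel_measurableI)
  fix S :: "'a set" assume "open S"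
  obtain D where D: "countable D" "D \<subseteq> K" "K \<subseteq> closure D"
    using separable by blast
  obtain E where E: "countable E" "E \<subseteq> K - S" "K - S \<subseteq> closure E"
    using separable by blast
  define B where "B = {\<omega> \<in> space N. \<forall>k::nat. \<exists>x\<in>E. \<forall>y\<in>D. h x \<omega> \<le> h y \<omega> + 1 / Suc k}"
  have [measurable]: "h x \<in> borel_measurable N" if "x \<in> E" for x
    using that E(2) h by blast
  have [measurable]: "h x \<in> borel_measurable N" if "x \<in> D" for x
    using that D(2) h by blast
  have "B \<in> sets N"
    unfolding B_def using D(1) E(1) by measurable
  have "b \<omega> \<notin> S \<longleftrightarrow> \<omega> \<in> B" if \<omega>: "\<omega> \<in> space N" for \<omega>
  proof
    assume "b \<omega> \<notin> S"
    then have "b \<omega> \<in> closure E"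
      using b[OF \<omega>] E(3) by blast
    then obtain x where x: "\<And>n. x n \<in> E" "x \<longlonglongrightarrow> b \<omega>"
      unfolding closure_sequential by blast
    then have lim: "(\<lambda>n. h (x n) \<omega>) \<longlonglongrightarrow> h (b \<omega>) \<omega>"
      using x(1) E(2) by (intro continuous_on_tendsto_compose[OF cont[OF \<omega>] x(2) b[OF \<omega>]] always_eventually) blast
    have "\<exists>x\<in>E. \<forall>y\<in>D. h x \<omega> \<le> h y \<omega> + 1 / Suc k" for k
    proof -
      have "\<forall>\<^sub>F n in sequentially. h (x n) \<omega> < h (b \<omega>) \<omega> + 1 / Suc k"
        by (rule order_tendstoD(2)[OF lim]) simp
      then obtain n where "h (x n) \<omega> < h (b \<omega>) \<omega> + 1 / Suc k"
        using eventually_happens trivial_limit_sequentially by blast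
      then show ?thesis
        using x(1)[of n] min[OF \<omega>] D(2) by (intro bexI[of _ "x n"] ballI) (fastforce+)
    qed
    then show "\<omega> \<in> B"
      using \<omega> unfolding B_def by blast
  next
    assume "\<omega> \<in> B"
    then obtain x where x: "\<And>k. x k \<in> E" "\<And>k y. y \<in> D \<Longrightarrow> h (x k) \<omega> \<le> h y \<omega> + 1 / Suc k"
      unfolding B_def by (simp add: Bex_def) metis
    have "compact (K - S)"
      using K \<open>open S\<close> by (rule compact_diff)
    moreover have "\<forall>k. x k \<in> K - S"
      using x(1) E(2) by blast
    ultimately obtain l r where l: "l \<in> K - S" "strict_mono r" "(x \<circ> r) \<longlonglongrightarrow> l"
      unfolding compact_def by metis
    have lim: "(\<lambda>k. h (x (r k)) \<omega>) \<longlonglongrightarrow> h l \<omega>"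
      using continuous_on_tendsto_compose[OF cont[OF \<omega>] l(3)] l(1) x(1) E(2)
      by (auto simp: o_def intro!: always_eventually)
    have le: "h l \<omega> \<le> h y \<omega>" if "y \<in> D" for y
    proof (rule LIMSEQ_le[OF lim])
      show "(\<lambda>k. h y \<omega> + 1 / Suc (r k)) \<longlonglongrightarrow> h y \<omega>"
        using LIMSEQ_subseq_LIMSEQ[OF LIMSEQ_inverse_real_of_nat_add[of "h y \<omega>"] l(2)]
        by (simp add: o_def inverse_eq_divide)
    qed (use x(2) that in auto)
    have "h l \<omega> \<le> h y \<omega>" if y: "y \<in> K" for y
    proof -
      obtain d where d: "\<And>n. d n \<in> D" "d \<longlonglongrightarrow> y"
        using subsetD[OF D(3) y] unfolding closure_sequential by blast
      then have "(\<lambda>n. h (d n) \<omega>) \<longlonglongrightarrow> h y \<omega>"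
        using D(2) by (intro continuous_on_tendsto_compose[OF cont[OF \<omega>] d(2) y] always_eventually) blast
      then show ?thesis
        using le d(1) by (intro LIMSEQ_le_const) auto
    qed
    then have "l = b \<omega>"
      using l(1) by (intro uniq[OF \<omega>]) auto
    with l(1) show "b \<omega> \<notin> S" by blast
  qed
  then have "b -` S \<inter> space N = space N - B"
    by auto
  with \<open>B \<in> sets N\<close> show "b -` S \<inter> space N \<in> sets N"
    by simp
qed

section \<open>The path of penalized minimizers\<close>

text \<open>
  The last conjunct selects, among several minimizers at \<open>t = 0\<close>, one with the smallest penalty. A
  minimizer at \<open>t > 0\<close> satisfies it automatically (see \<open>opt_exists\<close> below), so imposing it for every
  \<open>t\<close> costs nothing and gives all \<open>t\<close> the same closed description.
\<close>

definition penalty_path :: "'a set \<Rightarrow> ('a \<Rightarrow> real) \<Rightarrow> ('a \<Rightarrow> real) \<Rightarrow> real \<Rightarrow> 'a" where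
  "penalty_path K m j t = (SOME x. x \<in> K \<and> (\<forall>y\<in>K. m x + t * j x \<le> m y + t * j y) \<and>
     (\<forall>y\<in>K. (\<forall>z\<in>K. m y \<le> m z) \<longrightarrow> j x \<le> j y))"

locale penalty_problem =
  fixes K :: "'a::euclidean_space set" and m j :: "'a \<Rightarrow> real"
  assumes K: "compact K" "convex K" "K \<noteq> {}"
    and cont: "continuous_on K m" "continuous_on K j"
    and convex: "convex_on K m" "convex_on K j"
    and strict: "strictly_convex_on K m \<or> strictly_convex_on K j"
begin

lemma strictly_convex_penalized:
  assumes "0 < t \<or> strictly_convex_on K m" "0 \<le> t"
  shows "strictly_convex_on K (\<lambda>x. m x + t * j x)"
  using strict assms by (intro strictly_convex_on_add_scaled K convex) auto

definition opt :: "real \<Rightarrow> 'a \<Rightarrow> bool" where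
  "opt t x \<longleftrightarrow> x \<in> K \<and> (\<forall>y\<in>K. m x + t * j x \<le> m y + t * j y) \<and>
     (\<forall>y\<in>K. (\<forall>z\<in>K. m y \<le> m z) \<longrightarrow> j x \<le> j y)"

lemma opt_exists:
  assumes "0 \<le> t"
  shows "\<exists>x. opt t x"
proof (cases "t = 0")
  case True
  have "closed {x \<in> K. m x \<le> m y}" for y
    using K(1) cont by (intro continuous_on_closed_Collect_le compact_imp_closed) auto
  then have "closed (\<Inter>y\<in>K. {x \<in> K. m x \<le> m y})"
    by blast
  moreover have "(\<Inter>y\<in>K. {x \<in> K. m x \<le> m y}) = {x \<in> K. \<forall>y\<in>K. m x \<le> m y}" (is "_ = ?A")
    using K(3) by auto
  ultimately have "compact (K \<inter> ?A)"
    using K(1) by (intro compact_Int_closed) auto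
  then have "compact ?A"
    by (simp add: Int_absorb1)
  moreover have "?A \<noteq> {}"
    using continuous_attains_inf[OF K(1,3) cont(1)] by blast
  moreover have "continuous_on ?A j"
    using cont(2) by (rule continuous_on_subset) auto
  ultimately obtain x where "x \<in> ?A" "\<forall>y\<in>?A. j x \<le> j y"
    using continuous_attains_inf[of ?A j] by blast
  then show ?thesis
    using True unfolding opt_def by auto
next
  case False
  with assms have "0 < t" by simp
  have "continuous_on K (\<lambda>x. m x + t * j x)"
    using cont by (intro continuous_intros)
  then obtain x where x: "x \<in> K" "\<And>y. y \<in> K \<Longrightarrow> m x + t * j x \<le> m y + t * j y"
    using continuous_attains_inf[OF K(1,3)] by blast
  have "j x \<le> j y" if "y \<in> K" "\<forall>z\<in>K. m y \<le> m z" for y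
  proof -
    have "t * j x \<le> t * j y"
      using x(2)[OF that(1)] that(2) x(1) by fastforce
    then show ?thesis
      using \<open>0 < t\<close> by simp
  qed
  with x show ?thesis
    unfolding opt_def by blast
qed

text \<open>
  At \<open>t = 0\<close>, with only \<open>j\<close> strictly convex, uniqueness comes from minimizing \<open>j\<close> over the convex set
  of minimizers of \<open>m\<close>.
\<close>

lemma opt_unique:
  assumes "opt t x" "opt t y" "0 \<le> t"
  shows "x = y"
proof (cases "0 < t \<or> strictly_convex_on K m")
  case True
  then show ?thesis
    using strictly_convex_on_minimizer_unique[OF strictly_convex_penalized[OF True \<open>0 \<le> t\<close>] K(2)] assms
    unfolding opt_def by blast
next
  case False
  then have t: "t = 0" and j: "strictly_convex_on K j"
    using assms strict by auto
  define A where "A = {x \<in> K. \<forall>y\<in>K. m x \<le> m y}"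
  have xy: "x \<in> A" "y \<in> A" "\<And>z. z \<in> A \<Longrightarrow> j x \<le> j z" "\<And>z. z \<in> A \<Longrightarrow> j y \<le> j z"
    using assms t unfolding opt_def A_def by auto
  have "A = {z \<in> K. m z \<le> m x}"
    using xy(1) unfolding A_def by (auto intro: order_trans)
  moreover have "convex {z \<in> K. m z \<le> m x}"
  proof (rule convexI, safe)
    fix v w and p q :: real
    assume *: "v \<in> K" "m v \<le> m x" "w \<in> K" "m w \<le> m x" "0 \<le> p" "0 \<le> q" "p + q = 1"
    then show "p *\<^sub>R v + q *\<^sub>R w \<in> K"
      using K(2) by (simp add: convex_def)
    have "m (p *\<^sub>R v + q *\<^sub>R w) \<le> p * m v + q * m w"
      using * convex(1) by (simp add: convex_on_def)
    also have "\<dots> \<le> m x"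
      using * by (intro convex_bound_le) auto
    finally show "m (p *\<^sub>R v + q *\<^sub>R w) \<le> m x" .
  qed
  ultimately have "convex A" by simp
  moreover have "strictly_convex_on A j"
    using j by (rule strictly_convex_on_subset) (auto simp: A_def)
  ultimately show ?thesis
    using strictly_convex_on_minimizer_unique xy by metis
qed

lemma penalty_path_opt:
  assumes "0 \<le> t"
  shows "opt t (penalty_path K m j t)"
  using someI_ex[OF opt_exists[OF assms]] unfolding penalty_path_def opt_def .

lemma penalty_path_in: "0 \<le> t \<Longrightarrow> penalty_path K m j t \<in> K"
  using penalty_path_opt unfolding opt_def by blast

lemma penalty_path_min:
  "0 \<le> t \<Longrightarrow> y \<in> K \<Longrightarrow>
    m (penalty_path K m j t) + t * j (penalty_path K m j t) \<le> m y + t * j y"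
  using penalty_path_opt unfolding opt_def by blast

lemma penalty_path_unique:
  assumes "0 < t" "x \<in> K" "\<And>y. y \<in> K \<Longrightarrow> m x + t * j x \<le> m y + t * j y"
  shows "x = penalty_path K m j t"
  using strictly_convex_on_minimizer_unique[OF strictly_convex_penalized[of t] K(2), of x "penalty_path K m j t"]
    assms penalty_path_in[of t] penalty_path_min[of t] by simp

text \<open>
  The predicate \<open>opt\<close> is a conjunction of non-strict inequalities between functions continuous on
  \<open>{0..} \<times> K\<close>, so the graph of the path is closed; a function with closed graph and values in a
  compact set is continuous.
\<close>

lemma continuous_on_penalty_path: "continuous_on {0..} (penalty_path K m j)"
proof (rule continuous_from_closed_graph[OF K(1)])
  show "penalty_path K m j \<in> {0..} \<rightarrow> K"
    using penalty_path_in by auto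
  let ?S = "{0::real..} \<times> K"
  have S: "closed ?S"
    by (rule closed_Times[OF closed_atLeast compact_imp_closed[OF K(1)]])
  have m: "continuous_on ?S (\<lambda>p. m (snd p))" and j: "continuous_on ?S (\<lambda>p. j (snd p))"
    by (auto intro!: continuous_on_compose2[OF cont(1)] continuous_on_compose2[OF cont(2)] continuous_intros)
  have "(\<lambda>t. (t, penalty_path K m j t)) ` {0..} = {p \<in> ?S. opt (fst p) (snd p)}"
    using penalty_path_opt penalty_path_in opt_unique[OF _ penalty_path_opt]
    by (auto simp: image_iff)
  also have "\<dots> = ?S \<inter> (\<Inter>y\<in>K. {p \<in> ?S. m (snd p) + fst p * j (snd p) \<le> m y + fst p * j y}) \<inter>
      (\<Inter>y\<in>{y\<in>K. \<forall>z\<in>K. m y \<le> m z}. {p \<in> ?S. j (snd p) \<le> j y})"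
    unfolding opt_def by auto
  also have "closed \<dots>"
    by (intro closed_Int S closed_INT ballI continuous_on_closed_Collect_le continuous_intros m j)
  finally show "closed ((\<lambda>t. (t, penalty_path K m j t)) ` {0..})" .
qed

end

text \<open>
  At \<open>t = 0\<close> the minimizer may fail to be unique, which rules out \<open>measurable_unique_minimizer\<close>;
  there the path is the limit of its values at positive parameters.
\<close>

lemma measurable_penalty_path:
  fixes m :: "'a::euclidean_space \<Rightarrow> 'w \<Rightarrow> real"
  assumes "compact K" "0 \<le> t"
    and problem: "\<And>\<omega>. \<omega> \<in> space N \<Longrightarrow> penalty_problem K (\<lambda>x. m x \<omega>) j"
    and m: "\<And>x. x \<in> K \<Longrightarrow> m x \<in> borel_measurable N"
  shows "(\<lambda>\<omega>. penalty_path K (\<lambda>x. m x \<omega>) j t) \<in> borel_measurable N"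
proof -
  have pos: "(\<lambda>\<omega>. penalty_path K (\<lambda>x. m x \<omega>) j t) \<in> borel_measurable N" if "0 < t" for t
  proof (rule measurable_unique_minimizer[OF \<open>compact K\<close>, where h = "\<lambda>x \<omega>. m x \<omega> + t * j x"])
    fix \<omega> assume "\<omega> \<in> space N"
    then interpret penalty_problem K "\<lambda>x. m x \<omega>" j
      by (rule problem)
    show "continuous_on K (\<lambda>x. m x \<omega> + t * j x)"
      using cont by (intro continuous_intros)
    show "penalty_path K (\<lambda>x. m x \<omega>) j t \<in> K"
      using that penalty_path_in by simp
    show "m (penalty_path K (\<lambda>x. m x \<omega>) j t) \<omega> + t * j (penalty_path K (\<lambda>x. m x \<omega>) j t) \<le> m y \<omega> + t * j y"
      if "y \<in> K" for y
      using \<open>0 < t\<close> penalty_path_min that by simp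
    show "x = penalty_path K (\<lambda>x. m x \<omega>) j t"
      if "x \<in> K" "\<And>y. y \<in> K \<Longrightarrow> m x \<omega> + t * j x \<le> m y \<omega> + t * j y" for x
      using penalty_path_unique[OF \<open>0 < t\<close> that] .
  qed (use m in measurable)
  show ?thesis
  proof (rule borel_measurable_LIMSEQ_metric)
    show "(\<lambda>\<omega>. penalty_path K (\<lambda>x. m x \<omega>) j (t + inverse (real (Suc k)))) \<in> borel_measurable N" for k
      using \<open>0 \<le> t\<close> by (intro pos) (simp add: add_nonneg_pos)
    fix \<omega> assume "\<omega> \<in> space N"
    then interpret penalty_problem K "\<lambda>x. m x \<omega>" j
      by (rule problem)
    show "(\<lambda>k. penalty_path K (\<lambda>x. m x \<omega>) j (t + inverse (real (Suc k))))
        \<longlonglongrightarrow> penalty_path K (\<lambda>x. m x \<omega>) j t"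
      using \<open>0 \<le> t\<close> LIMSEQ_inverse_real_of_nat_add[of t]
      by (intro continuous_on_tendsto_compose[OF continuous_on_penalty_path]) auto
  qed
qed

section \<open>Events of probability tending to one\<close>

definition asymptotically_sure :: "'w measure \<Rightarrow> (nat \<Rightarrow> 'w set) \<Rightarrow> bool" where
  "asymptotically_sure P E \<longleftrightarrow> (\<forall>n. E n \<in> sets P) \<and> (\<lambda>n. measure P (E n)) \<longlonglongrightarrow> 1"

lemma (in prob_space) asymptotically_sure_iff_compl:
  "asymptotically_sure M E \<longleftrightarrow> (\<forall>n. E n \<in> events) \<and> (\<lambda>n. prob (space M - E n)) \<longlonglongrightarrow> 0"
proof (cases "\<forall>n. E n \<in> events")
  case True
  then have "(\<lambda>n. prob (space M - E n)) = (\<lambda>n. 1 - prob (E n))"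
    by (auto simp: prob_compl)
  moreover have "(\<lambda>n. 1 - prob (E n)) \<longlonglongrightarrow> 0 \<longleftrightarrow> (\<lambda>n. prob (E n)) \<longlonglongrightarrow> 1"
    using tendsto_diff[OF tendsto_const[of 1], of "\<lambda>n. prob (E n)" 1 sequentially]
      tendsto_diff[OF tendsto_const[of 1], of "\<lambda>n. 1 - prob (E n)" 0 sequentially] by auto
  ultimately show ?thesis
    unfolding asymptotically_sure_def by simp
qed (auto simp: asymptotically_sure_def)

lemma (in prob_space) asymptotically_sure_Int:
  assumes "asymptotically_sure M E" "asymptotically_sure M F"
  shows "asymptotically_sure M (\<lambda>n. E n \<inter> F n)"
  unfolding asymptotically_sure_iff_compl
proof (intro conjI allI)
  have ev: "E n \<in> events" "F n \<in> events" for n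
    using assms unfolding asymptotically_sure_def by auto
  then show "E n \<inter> F n \<in> events" for n by blast
  show "(\<lambda>n. prob (space M - E n \<inter> F n)) \<longlonglongrightarrow> 0"
  proof (rule tendsto_sandwich[OF _ _ tendsto_const])
    show "(\<lambda>n. prob (space M - E n) + prob (space M - F n)) \<longlonglongrightarrow> 0"
      using assms unfolding asymptotically_sure_iff_compl by (intro tendsto_add_zero) auto
    have "prob (space M - E n \<inter> F n) \<le> prob (space M - E n) + prob (space M - F n)" for n
      unfolding Diff_Int using ev by (intro measure_Un_le) auto
    then show "\<forall>\<^sub>F n in sequentially. prob (space M - E n \<inter> F n) \<le> prob (space M - E n) + prob (space M - F n)"
      by simp
  qed simp
qed

lemma (in prob_space) asymptotically_sure_finite_INT:
  assumes "finite S" "\<And>x. x \<in> S \<Longrightarrow> asymptotically_sure M (E x)"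
  shows "asymptotically_sure M (\<lambda>n. space M \<inter> (\<Inter>x\<in>S. E x n))"
  using assms
proof (induction S)
  case empty
  then show ?case
    by (simp add: asymptotically_sure_def prob_space)
next
  case (insert x S)
  then have "asymptotically_sure M (\<lambda>n. E x n \<inter> (space M \<inter> (\<Inter>x\<in>S. E x n)))"
    by (intro asymptotically_sure_Int insert.IH insert.prems) auto
  moreover have "E x n \<inter> (space M \<inter> (\<Inter>x\<in>S. E x n)) = space M \<inter> (\<Inter>x\<in>insert x S. E x n)" for n
    by auto
  ultimately show ?case
    by simp
qed

lemma (in prob_space) asymptotically_sure_of_AE:
  assumes "\<And>n. AE \<omega> in M. Q n \<omega>"
  obtains E where "asymptotically_sure M E" "\<And>n \<omega>. \<omega> \<in> E n \<Longrightarrow> Q n \<omega>"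
proof -
  have "\<exists>N. N \<in> null_sets M \<and> (\<forall>\<omega>\<in>space M - N. Q n \<omega>)" for n
    using AE_E3[OF assms[of n]] by metis
  then obtain N where N: "\<And>n. N n \<in> null_sets M" "\<And>n \<omega>. \<omega> \<in> space M - N n \<Longrightarrow> Q n \<omega>"
    by metis
  have "measure M (space M - N n) = 1" for n
    using N(1) by (simp add: measure_Diff_null_set prob_space)
  then have "asymptotically_sure M (\<lambda>n. space M - N n)"
    using N(1) unfolding asymptotically_sure_def by auto
  then show ?thesis
    using that N(2) by blast
qed

lemma outer_measure_of_Un_le:
  assumes "A \<subseteq> space M" "B \<in> sets M"
  shows "outer_measure_of M (A \<union> B) \<le> outer_measure_of M A + emeasure M B"
proof -
  obtain E where E: "E \<in> sets M" "A \<subseteq> E" "outer_measure_of M A = emeasure M E"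
    using outer_measure_of_attain[OF assms(1)] by blast
  have "outer_measure_of M (A \<union> B) \<le> outer_measure_of M (E \<union> B)"
    using E(2) by (intro outer_measure_of_mono) auto
  also have "\<dots> \<le> emeasure M E + emeasure M B"
    using E(1) assms(2) by (simp add: emeasure_subadditive)
  finally show ?thesis
    using E(3) by simp
qed

text \<open>
  For sequences of arbitrary sets, an inclusion that holds on asymptotically sure events is
  as good as an inclusion everywhere.
\<close>

lemma (in prob_space) outer_measure_tendsto_zero:
  assumes E: "asymptotically_sure M E"
    and S: "(\<lambda>n. outer_measure_of M (S n)) \<longlonglongrightarrow> 0" "\<And>n. S n \<subseteq> space M"
    and T: "\<forall>\<^sub>F n in sequentially. T n \<inter> E n \<subseteq> S n" "\<And>n. T n \<subseteq> space M"
  shows "(\<lambda>n. outer_measure_of M (T n)) \<longlonglongrightarrow> 0"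
proof (rule tendsto_sandwich[OF _ _ tendsto_const])
  have ev: "E n \<in> events" for n
    using E unfolding asymptotically_sure_def by auto
  have "(\<lambda>n. emeasure M (space M - E n)) \<longlonglongrightarrow> 0"
    using E unfolding asymptotically_sure_iff_compl emeasure_eq_measure
    by (subst ennreal_tendsto_0_iff) auto
  then show "(\<lambda>n. outer_measure_of M (S n) + emeasure M (space M - E n)) \<longlonglongrightarrow> 0"
    using tendsto_add[OF S(1)] by fastforce
  show "\<forall>\<^sub>F n in sequentially. outer_measure_of M (T n) \<le> outer_measure_of M (S n) + emeasure M (space M - E n)"
    using T(1)
  proof eventually_elim
    case (elim n)
    then have "outer_measure_of M (T n) \<le> outer_measure_of M (S n \<union> (space M - E n))"
      using T(2)[of n] by (intro outer_measure_of_mono) auto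
    also have "\<dots> \<le> outer_measure_of M (S n) + emeasure M (space M - E n)"
      using S(2) ev by (intro outer_measure_of_Un_le) auto
    finally show ?case .
  qed
qed simp

lemma (in prob_space) tendsto_zero_prob_of_outer:
  assumes "tendsto_zero_outer_prob M Y" "\<And>n. Y n \<in> borel_measurable M"
  shows "tendsto_zero_prob M Y"
  unfolding tendsto_zero_prob_def
proof (intro conjI allI impI)
  fix \<epsilon> :: real assume "0 < \<epsilon>"
  have [measurable]: "Y n \<in> borel_measurable M" for n
    by fact
  have "{\<omega> \<in> space M. ereal \<epsilon> \<le> \<bar>Y n \<omega>\<bar>} \<in> events" for n
    by measurable
  then have "(\<lambda>n. ennreal (prob {\<omega> \<in> space M. ereal \<epsilon> \<le> \<bar>Y n \<omega>\<bar>})) \<longlonglongrightarrow> 0"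
    using assms(1) \<open>0 < \<epsilon>\<close> unfolding tendsto_zero_outer_prob_def by (simp flip: emeasure_eq_measure)
  then show "(\<lambda>n. prob {\<omega> \<in> space M. ereal \<epsilon> \<le> \<bar>Y n \<omega>\<bar>}) \<longlonglongrightarrow> 0"
    by (subst (asm) ennreal_tendsto_0_iff) auto
qed fact

lemma (in prob_space) asymptotically_sure_close:
  assumes "tendsto_zero_prob M (\<lambda>n \<omega>. ereal (X n \<omega> - c))" "0 < \<delta>"
    and X: "\<And>n. X n \<in> borel_measurable M"
  shows "asymptotically_sure M (\<lambda>n. {\<omega> \<in> space M. \<bar>X n \<omega> - c\<bar> < \<delta>})"
  unfolding asymptotically_sure_iff_compl
proof (intro conjI allI)
  note [measurable] = X
  show "{\<omega> \<in> space M. \<bar>X n \<omega> - c\<bar> < \<delta>} \<in> events" for n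
    by measurable
  have "space M - {\<omega> \<in> space M. \<bar>X n \<omega> - c\<bar> < \<delta>} = {\<omega> \<in> space M. ereal \<delta> \<le> \<bar>ereal (X n \<omega> - c)\<bar>}" for n
    by auto
  then show "(\<lambda>n. prob (space M - {\<omega> \<in> space M. \<bar>X n \<omega> - c\<bar> < \<delta>})) \<longlonglongrightarrow> 0"
    using assms(1,2) unfolding tendsto_zero_prob_def by simp
qed

text \<open>
  Continuity in the index reduces the supremum to a countable dense set of indices.
\<close>

lemma borel_measurable_SUP_dense:
  fixes f :: "real \<Rightarrow> 'w \<Rightarrow> real"
  assumes meas: "\<And>t. t \<in> T \<Longrightarrow> f t \<in> borel_measurable N"
    and cont: "\<And>\<omega>. \<omega> \<in> space N \<Longrightarrow> continuous_on T (\<lambda>t. f t \<omega>)"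
  shows "(\<lambda>\<omega>. SUP t\<in>T. ereal (f t \<omega>)) \<in> borel_measurable N"
proof -
  obtain D where D: "countable D" "D \<subseteq> T" "T \<subseteq> closure D"
    using separable by blast
  have eq: "(SUP t\<in>T. ereal (f t \<omega>)) = (SUP t\<in>D. ereal (f t \<omega>))" if "\<omega> \<in> space N" for \<omega>
  proof (rule antisym)
    show "(SUP t\<in>T. ereal (f t \<omega>)) \<le> (SUP t\<in>D. ereal (f t \<omega>))"
    proof (rule SUP_least)
      fix t assume t: "t \<in> T"
      then have "t \<in> closure D"
        using D(3) by blast
      then obtain d where d: "\<And>n. d n \<in> D" "d \<longlonglongrightarrow> t"
        unfolding closure_sequential by blast
      then have "(\<lambda>n. f (d n) \<omega>) \<longlonglongrightarrow> f t \<omega>"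
        using D(2) by (intro continuous_on_tendsto_compose[OF cont[OF \<open>\<omega> \<in> space N\<close>] d(2) t] always_eventually) blast
      then have "(\<lambda>n. ereal (f (d n) \<omega>)) \<longlonglongrightarrow> ereal (f t \<omega>)"
        by (rule tendsto_ereal)
      then show "ereal (f t \<omega>) \<le> (SUP t\<in>D. ereal (f t \<omega>))"
        by (rule LIMSEQ_le_const2) (use d(1) in \<open>auto intro!: exI[of _ 0] SUP_upper\<close>)
    qed
  qed (use D(2) in \<open>auto intro: SUP_subset_mono\<close>)
  have "(\<lambda>\<omega>. SUP t\<in>D. ereal (f t \<omega>)) \<in> borel_measurable N"
    using D(1,2) meas by (intro borel_measurable_SUP) auto
  then show ?thesis
    using eq by (subst measurable_cong) auto
qed

section \<open>Convergence and existence of penalized minimizers\<close>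

locale convex_limit_problem = prob_space P for P :: "'w measure" +
  fixes \<Phi> V :: "'a::euclidean_space set"
    and M :: "nat \<Rightarrow> 'a \<Rightarrow> 'w \<Rightarrow> real"
    and J :: "nat \<Rightarrow> 'a \<Rightarrow> real"
    and \<Delta> :: "'a \<Rightarrow> real"
    and \<beta> :: 'a
  assumes convex_\<Phi>: "convex \<Phi>"
    and M_measurable: "\<And>n \<phi>. \<phi> \<in> \<Phi> \<Longrightarrow> M n \<phi> \<in> borel_measurable P"
    and M_convex: "\<And>n. AE \<omega> in P. convex_on \<Phi> (\<lambda>\<phi>. M n \<phi> \<omega>)"
    and \<beta>_in: "\<beta> \<in> \<Phi>"
    and V: "V \<subseteq> \<Phi>" "\<beta> \<in> interior V"
    and \<Delta>_strict: "strictly_convex_on V \<Delta>"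
    and M_tendsto: "\<And>\<phi>. \<phi> \<in> V \<Longrightarrow> tendsto_zero_prob P (\<lambda>n \<omega>. ereal (M n \<phi> \<omega> - \<Delta> \<phi>))"
    and \<Delta>_min: "\<And>\<phi>. \<phi> \<in> V \<Longrightarrow> \<Delta> \<beta> \<le> \<Delta> \<phi>"
    and J_nonneg: "\<And>n \<phi>. \<phi> \<in> \<Phi> \<Longrightarrow> 0 \<le> J n \<phi>"
    and J_tendsto: "(\<lambda>n. J n \<beta>) \<longlonglongrightarrow> 0"
begin

text \<open>
  The set \<open>F\<close> of \<open>uniform_growth_on_sphere\<close> is finite and independent of \<open>n\<close> and of the outcome, so the
  event that \<open>M n\<close> is close to \<open>\<Delta>\<close> on \<open>F\<close> is a finite intersection of asymptotically sure events.
\<close>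

lemma growth_events:
  "\<exists>\<rho>>0. ball \<beta> \<rho> \<subseteq> \<Phi> \<and> (\<forall>r. 0 < r \<and> r < \<rho> \<longrightarrow>
    (\<exists>\<eta>>0. \<exists>E. asymptotically_sure P E \<and>
       (\<forall>n. \<forall>\<omega>\<in>E n. convex_on \<Phi> (\<lambda>\<phi>. M n \<phi> \<omega>) \<and> (\<forall>s\<in>sphere \<beta> r. M n \<beta> \<omega> + \<eta> \<le> M n s \<omega>))))"
proof -
  obtain R where R: "0 < R" "ball \<beta> R \<subseteq> V"
    using V(2) mem_interior by blast
  have strict: "strictly_convex_on (ball \<beta> R) \<Delta>"
    using \<Delta>_strict R(2) by (rule strictly_convex_on_subset)
  have gt: "\<Delta> \<beta> < \<Delta> x" if "x \<in> ball \<beta> R" "x \<noteq> \<beta>" for x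
  proof (rule ccontr)
    assume "\<not> \<Delta> \<beta> < \<Delta> x"
    then have "\<Delta> x \<le> \<Delta> z" if "z \<in> ball \<beta> R" for z
      using that R(2) \<Delta>_min[of z] by auto
    then show False
      using strictly_convex_on_minimizer_unique[OF strict convex_ball, of x \<beta>] \<Delta>_min R that
      by (auto simp: subset_iff)
  qed
  have ball: "open (ball \<beta> R)" "\<beta> \<in> ball \<beta> R" "convex_on (ball \<beta> R) \<Delta>"
    using R(1) strict by (auto intro: strictly_convex_on_imp_convex_on)
  obtain \<rho> where \<rho>: "0 < \<rho>" "ball \<beta> \<rho> \<subseteq> ball \<beta> R"
    "\<forall>r. 0 < r \<and> r < \<rho> \<longrightarrow> (\<exists>F \<delta> \<eta>. finite F \<and> F \<subseteq> ball \<beta> R \<and> 0 < \<delta> \<and> 0 < \<eta> \<and>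
       (\<forall>f. convex_on (ball \<beta> R) f \<longrightarrow> (\<forall>x\<in>F. \<bar>f x - \<Delta> x\<bar> < \<delta>) \<longrightarrow>
         (\<forall>s\<in>sphere \<beta> r. f \<beta> + \<eta> \<le> f s)))"
    using uniform_growth_on_sphere[OF ball gt] by auto
  obtain C where C: "asymptotically_sure P C" "\<And>n \<omega>. \<omega> \<in> C n \<Longrightarrow> convex_on \<Phi> (\<lambda>\<phi>. M n \<phi> \<omega>)"
    using asymptotically_sure_of_AE[of "\<lambda>n \<omega>. convex_on \<Phi> (\<lambda>\<phi>. M n \<phi> \<omega>)", OF M_convex] by blast
  show ?thesis
  proof (rule exI[of _ \<rho>], intro conjI allI impI \<rho>(1); (elim conjE)?)
    show "ball \<beta> \<rho> \<subseteq> \<Phi>"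
      using \<rho>(2) R(2) V(1) by blast
    fix r :: real assume "0 < r" "r < \<rho>"
    then obtain F \<delta> \<eta> where F: "finite F" "F \<subseteq> ball \<beta> R" "0 < \<delta>" "0 < \<eta>"
      and growth: "\<forall>f. convex_on (ball \<beta> R) f \<longrightarrow> (\<forall>x\<in>F. \<bar>f x - \<Delta> x\<bar> < \<delta>) \<longrightarrow>
        (\<forall>s\<in>sphere \<beta> r. f \<beta> + \<eta> \<le> f s)"
      using \<rho>(3)[rule_format, OF conjI[OF \<open>0 < r\<close> \<open>r < \<rho>\<close>]] by blast
    define G where "G x n = {\<omega> \<in> space P. \<bar>M n x \<omega> - \<Delta> x\<bar> < \<delta>}" for x n
    have "asymptotically_sure P (G x)" if "x \<in> F" for x
      unfolding G_def using that F(2,3) R(2) V(1)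
      by (intro asymptotically_sure_close M_tendsto M_measurable) auto
    then have "asymptotically_sure P (\<lambda>n. C n \<inter> (space P \<inter> (\<Inter>x\<in>F. G x n)))"
      using F(1) C(1) by (intro asymptotically_sure_Int asymptotically_sure_finite_INT)
    moreover have "convex_on \<Phi> (\<lambda>\<phi>. M n \<phi> \<omega>)"
      and "\<forall>s\<in>sphere \<beta> r. M n \<beta> \<omega> + \<eta> \<le> M n s \<omega>"
      if \<omega>: "\<omega> \<in> C n \<inter> (space P \<inter> (\<Inter>x\<in>F. G x n))" for n \<omega>
    proof -
      show c: "convex_on \<Phi> (\<lambda>\<phi>. M n \<phi> \<omega>)"
        using C(2) \<omega> by blast
      then have "convex_on (ball \<beta> R) (\<lambda>\<phi>. M n \<phi> \<omega>)"
        using R(2) V(1) by (intro convex_on_subset[OF c]) auto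
      then show "\<forall>s\<in>sphere \<beta> r. M n \<beta> \<omega> + \<eta> \<le> M n s \<omega>"
        using growth[THEN spec, of "\<lambda>\<phi>. M n \<phi> \<omega>"] \<omega> unfolding G_def by blast
    qed
    ultimately show "\<exists>\<eta>>0. \<exists>E. asymptotically_sure P E \<and> (\<forall>n. \<forall>\<omega>\<in>E n.
        convex_on \<Phi> (\<lambda>\<phi>. M n \<phi> \<omega>) \<and> (\<forall>s\<in>sphere \<beta> r. M n \<beta> \<omega> + \<eta> \<le> M n s \<omega>))"
      using F(4) by blast
  qed
qed

text \<open>
  On the growth event for a sphere of radius \<open>r < \<epsilon>\<close>, a near minimizer has \<open>M n\<close>-value below
  \<open>M n \<beta> + \<eta>\<close>: half of \<open>\<eta>\<close> pays for the minimization error, the other half for the penalty at \<open>\<beta>\<close>.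
\<close>

lemma near_minimizers_converge:
  assumes "0 \<le> L" and b: "valued_processes P \<Phi> b" and near: "near_minimizing P M J \<beta> L b"
  shows "tendsto_zero_outer_prob P (sup_dist \<beta> L b)"
  unfolding tendsto_zero_outer_prob_def
proof (intro allI impI)
  fix \<epsilon> :: real assume "0 < \<epsilon>"
  obtain \<rho> where \<rho>: "0 < \<rho>" "ball \<beta> \<rho> \<subseteq> \<Phi>"
    "\<forall>r. 0 < r \<and> r < \<rho> \<longrightarrow> (\<exists>\<eta>>0. \<exists>E. asymptotically_sure P E \<and>
       (\<forall>n. \<forall>\<omega>\<in>E n. convex_on \<Phi> (\<lambda>\<phi>. M n \<phi> \<omega>) \<and> (\<forall>s\<in>sphere \<beta> r. M n \<beta> \<omega> + \<eta> \<le> M n s \<omega>)))"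
    using growth_events by auto
  define r where "r = min \<epsilon> \<rho> / 2"
  have r: "0 < r" "r < \<rho>" "r < \<epsilon>"
    using \<open>0 < \<epsilon>\<close> \<rho>(1) unfolding r_def by (auto simp: min_def)
  obtain \<eta> E where \<eta>: "0 < \<eta>" and E: "asymptotically_sure P E"
    "\<And>n \<omega>. \<omega> \<in> E n \<Longrightarrow> convex_on \<Phi> (\<lambda>\<phi>. M n \<phi> \<omega>)"
    "\<And>n \<omega> s. \<omega> \<in> E n \<Longrightarrow> s \<in> sphere \<beta> r \<Longrightarrow> M n \<beta> \<omega> + \<eta> \<le> M n s \<omega>"
    using \<rho>(3)[rule_format, OF conjI[OF r(1,2)]] by blast
  define Y where "Y n \<omega> = (SUP t\<in>{0..L}.
    ereal (max 0 (penalized M J n (b n t \<omega>) t \<omega> - penalized M J n \<beta> t \<omega>)))" for n \<omega>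
  show "(\<lambda>n. outer_measure_of P {\<omega> \<in> space P. ereal \<epsilon> \<le> \<bar>sup_dist \<beta> L b n \<omega>\<bar>}) \<longlonglongrightarrow> 0"
  proof (rule outer_measure_tendsto_zero[OF E(1)])
    show "(\<lambda>n. outer_measure_of P {\<omega> \<in> space P. ereal (\<eta> / 2) \<le> \<bar>Y n \<omega>\<bar>}) \<longlonglongrightarrow> 0"
      using near \<eta> unfolding near_minimizing_def tendsto_zero_outer_prob_def Y_def by simp
    have "(\<lambda>n. L * J n \<beta>) \<longlonglongrightarrow> 0"
      using tendsto_mult_left[OF J_tendsto, of L] by simp
    then have "\<forall>\<^sub>F n in sequentially. L * J n \<beta> < \<eta> / 2"
      using \<eta> by (intro order_tendstoD(2)) auto
    then show "\<forall>\<^sub>F n in sequentially. {\<omega> \<in> space P. ereal \<epsilon> \<le> \<bar>sup_dist \<beta> L b n \<omega>\<bar>} \<inter> E n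
        \<subseteq> {\<omega> \<in> space P. ereal (\<eta> / 2) \<le> \<bar>Y n \<omega>\<bar>}"
    proof eventually_elim
      case (elim n)
      have "\<bar>sup_dist \<beta> L b n \<omega>\<bar> < ereal \<epsilon>"
        if \<omega>: "\<omega> \<in> space P" "\<omega> \<in> E n" and Y: "\<not> ereal (\<eta> / 2) \<le> \<bar>Y n \<omega>\<bar>" for \<omega>
      proof -
        have "norm (b n t \<omega> - \<beta>) < r" if t: "t \<in> {0..L}" for t
        proof (rule sublevel_within_sphere[OF E(2)[OF \<omega>(2)] \<beta>_in r(1) \<eta> E(3)[OF \<omega>(2)]])
          show in_\<Phi>: "b n t \<omega> \<in> \<Phi>"
            using b t \<omega>(1) unfolding valued_processes_def by auto
          have "ereal (penalized M J n (b n t \<omega>) t \<omega> - penalized M J n \<beta> t \<omega>) \<le> Y n \<omega>"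
            unfolding Y_def using t by (intro SUP_upper2[of t]) auto
          also have "\<dots> \<le> \<bar>Y n \<omega>\<bar>"
            by (cases "Y n \<omega>") auto
          also have "\<dots> < ereal (\<eta> / 2)"
            using Y by simp
          finally have "M n (b n t \<omega>) \<omega> + t * J n (b n t \<omega>) < M n \<beta> \<omega> + t * J n \<beta> + \<eta> / 2"
            unfolding penalized_def by simp
          moreover have "0 \<le> t * J n (b n t \<omega>)"
            using t J_nonneg[OF in_\<Phi>] by simp
          moreover have "t * J n \<beta> \<le> L * J n \<beta>"
            using t J_nonneg[OF \<beta>_in] by (intro mult_right_mono) auto
          ultimately show "M n (b n t \<omega>) \<omega> < M n \<beta> \<omega> + \<eta>"
            using elim by linarith
        qed
        then have "sup_dist \<beta> L b n \<omega> \<le> ereal r"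
          unfolding sup_dist_def by (intro SUP_least) (auto intro: less_imp_le)
        moreover have "0 \<le> sup_dist \<beta> L b n \<omega>"
          unfolding sup_dist_def using \<open>0 \<le> L\<close> by (intro SUP_upper2[of 0]) auto
        ultimately show ?thesis
          using r(3) by (simp add: le_less_trans[of _ "ereal r"])
      qed
      then show ?case
        by (auto simp: not_less[symmetric])
    qed
  qed auto
qed

text \<open>
  The path may jump at \<open>0\<close> and just after \<open>l\<close>, so the index range is cut into the three pieces on
  which it is continuous.
\<close>

lemma sup_dist_measurable:
  fixes b :: "nat \<Rightarrow> real \<Rightarrow> 'w \<Rightarrow> 'a"
  assumes b: "\<And>t. 0 \<le> t \<Longrightarrow> b n t \<in> borel_measurable P" and "0 \<le> L"
    and cont: "\<And>\<omega>. \<omega> \<in> space P \<Longrightarrow> continuous_on {0<..l} (\<lambda>t. b n t \<omega>)"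
      "\<And>\<omega>. \<omega> \<in> space P \<Longrightarrow> continuous_on {l<..} (\<lambda>t. b n t \<omega>)"
  shows "sup_dist \<beta> L b n \<in> borel_measurable P"
proof -
  define f where "f t \<omega> = norm (b n t \<omega> - \<beta>)" for t \<omega>
  have piece: "(\<lambda>\<omega>. SUP t\<in>T. ereal (f t \<omega>)) \<in> borel_measurable P"
    if "T \<subseteq> {0..}" "T \<subseteq> T'" and cont: "\<And>\<omega>. \<omega> \<in> space P \<Longrightarrow> continuous_on T' (\<lambda>t. b n t \<omega>)" for T T'
  proof (rule borel_measurable_SUP_dense)
    show "f t \<in> borel_measurable P" if "t \<in> T" for t
    proof -
      have [measurable]: "b n t \<in> borel_measurable P"
        using b[of t] that \<open>T \<subseteq> {0..}\<close> by auto
      show ?thesis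
        unfolding f_def by measurable
    qed
    show "continuous_on T (\<lambda>t. f t \<omega>)" if "\<omega> \<in> space P" for \<omega>
    proof -
      have "continuous_on T (\<lambda>t. b n t \<omega>)"
        using continuous_on_subset \<open>T \<subseteq> T'\<close> cont[OF that] by blast
      then show ?thesis
        unfolding f_def by (intro continuous_intros)
    qed
  qed
  have T: "{0..L} = {0} \<union> ({0<..l} \<inter> {0..L}) \<union> ({l<..} \<inter> {0..L})"
    using \<open>0 \<le> L\<close> by auto
  have "sup_dist \<beta> L b n = (\<lambda>\<omega>. sup (sup (SUP t\<in>{0}. ereal (f t \<omega>))
      (SUP t\<in>{0<..l} \<inter> {0..L}. ereal (f t \<omega>))) (SUP t\<in>{l<..} \<inter> {0..L}. ereal (f t \<omega>)))"
    unfolding sup_dist_def f_def[symmetric] by (subst T) (simp only: SUP_union)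
  also have "\<dots> \<in> borel_measurable P"
    by (intro borel_measurable_sup piece[of "{0}" "{0}"] piece[OF _ _ cont(1)] piece[OF _ _ cont(2)]) auto
  finally show ?thesis .
qed

lemma minimizers_converge:
  assumes adm: "admissible P \<Phi> Ls A b" and "0 < L"
    and min: "\<And>n t \<omega>. t \<in> {0..Ls n} \<Longrightarrow> \<omega> \<in> A n \<Longrightarrow>
      is_arg_min (\<lambda>\<phi>. penalized M J n \<phi> t \<omega>) (\<lambda>\<phi>. \<phi> \<in> \<Phi>) (b n t \<omega>)"
    and cont: "\<And>n \<omega>. \<omega> \<in> space P \<Longrightarrow> continuous_on {0<..Ls n} (\<lambda>t. b n t \<omega>)"
      "\<And>n \<omega>. \<omega> \<in> space P \<Longrightarrow> continuous_on {Ls n<..} (\<lambda>t. b n t \<omega>)"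
  shows "near_minimizing P M J \<beta> L b" "tendsto_zero_prob P (sup_dist \<beta> L b)"
proof -
  have A: "asymptotically_sure P A" and b: "valued_processes P \<Phi> b" and Ls: "filterlim Ls at_top sequentially"
    using adm unfolding admissible_def asymptotically_sure_def by auto
  show near: "near_minimizing P M J \<beta> L b"
    unfolding near_minimizing_def tendsto_zero_outer_prob_def
  proof (intro allI impI, rule outer_measure_tendsto_zero[OF A, where S = "\<lambda>_. {}"])
    fix \<epsilon> :: real assume "0 < \<epsilon>"
    let ?Y = "\<lambda>n \<omega>. SUP t\<in>{0..L}. ereal (max 0 (penalized M J n (b n t \<omega>) t \<omega> - penalized M J n \<beta> t \<omega>))"
    have "\<forall>\<^sub>F n in sequentially. L \<le> Ls n"
      using Ls by (simp add: filterlim_at_top)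
    then show "\<forall>\<^sub>F n in sequentially. {\<omega> \<in> space P. ereal \<epsilon> \<le> \<bar>?Y n \<omega>\<bar>} \<inter> A n \<subseteq> {}"
    proof eventually_elim
      case (elim n)
      have "?Y n \<omega> = 0" if "\<omega> \<in> A n" for \<omega>
      proof -
        have "?Y n \<omega> = (SUP t\<in>{0..L}. 0)"
        proof (rule SUP_cong[OF refl])
          fix t assume "t \<in> {0..L}"
          then have "penalized M J n (b n t \<omega>) t \<omega> \<le> penalized M J n \<beta> t \<omega>"
            using min[of t n \<omega>] elim that \<beta>_in unfolding is_arg_min_linorder by auto
          then show "ereal (max 0 (penalized M J n (b n t \<omega>) t \<omega> - penalized M J n \<beta> t \<omega>)) = 0"
            by simp
        qed
        then show ?thesis
          using \<open>0 < L\<close> by simp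
      qed
      then show ?case
        using \<open>0 < \<epsilon>\<close> by auto
    qed
  qed auto
  show "tendsto_zero_prob P (sup_dist \<beta> L b)"
  proof (rule tendsto_zero_prob_of_outer)
    show "tendsto_zero_outer_prob P (sup_dist \<beta> L b)"
      using \<open>0 < L\<close> by (intro near_minimizers_converge b near) simp
    show "sup_dist \<beta> L b n \<in> borel_measurable P" for n
      using b \<open>0 < L\<close> unfolding valued_processes_def
      by (intro sup_dist_measurable[OF _ _ cont]) auto
  qed
qed

text \<open>
  The predicate \<open>S\<close> carries the source of strict convexity to the events \<open>A n\<close>: with \<open>S\<close> strict
  convexity of \<open>M n\<close> the minimizers turn out unique also at \<open>t = 0\<close>, while a strictly convex penalty
  allows the trivial \<open>S\<close>. The path is continuous on the closed interval in both cases.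
\<close>

lemma minimizers_exist:
  assumes J_convex: "\<And>n. convex_on \<Phi> (J n)"
    and S_AE: "\<And>n. AE \<omega> in P. S n \<omega>"
    and strict: "\<And>n \<omega>. S n \<omega> \<Longrightarrow> strictly_convex_on \<Phi> (\<lambda>\<phi>. M n \<phi> \<omega>) \<or> strictly_convex_on \<Phi> (J n)"
  obtains Ls A b where "admissible P \<Phi> Ls A b"
    "\<And>n \<omega>. \<omega> \<in> A n \<Longrightarrow> convex_on \<Phi> (\<lambda>\<phi>. M n \<phi> \<omega>)"
    "\<And>n \<omega>. \<omega> \<in> A n \<Longrightarrow> S n \<omega>"
    "\<And>n t \<omega>. t \<in> {0..Ls n} \<Longrightarrow> \<omega> \<in> A n \<Longrightarrow>
      is_arg_min (\<lambda>\<phi>. penalized M J n \<phi> t \<omega>) (\<lambda>\<phi>. \<phi> \<in> \<Phi>) (b n t \<omega>)"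
    "\<And>n \<omega>. continuous_on {0..Ls n} (\<lambda>t. b n t \<omega>)"
    "\<And>n \<omega>. continuous_on {Ls n<..} (\<lambda>t. b n t \<omega>)"
proof -
  obtain \<rho> where \<rho>: "0 < \<rho>" "ball \<beta> \<rho> \<subseteq> \<Phi>"
    "\<forall>r. 0 < r \<and> r < \<rho> \<longrightarrow> (\<exists>\<eta>>0. \<exists>E. asymptotically_sure P E \<and>
       (\<forall>n. \<forall>\<omega>\<in>E n. convex_on \<Phi> (\<lambda>\<phi>. M n \<phi> \<omega>) \<and> (\<forall>s\<in>sphere \<beta> r. M n \<beta> \<omega> + \<eta> \<le> M n s \<omega>)))"
    using growth_events by auto
  define r where "r = \<rho> / 2"
  have r: "0 < r" "r < \<rho>"
    using \<rho>(1) unfolding r_def by auto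
  obtain \<eta> E where \<eta>: "0 < \<eta>" and E: "asymptotically_sure P E"
    "\<And>n \<omega>. \<omega> \<in> E n \<Longrightarrow> convex_on \<Phi> (\<lambda>\<phi>. M n \<phi> \<omega>)"
    "\<And>n \<omega> s. \<omega> \<in> E n \<Longrightarrow> s \<in> sphere \<beta> r \<Longrightarrow> M n \<beta> \<omega> + \<eta> \<le> M n s \<omega>"
    using \<rho>(3)[rule_format, OF conjI[OF r]] by blast
  obtain F where F: "asymptotically_sure P F"
    "\<And>n \<omega>. \<omega> \<in> F n \<Longrightarrow> S n \<omega>"
    using asymptotically_sure_of_AE[of S, OF S_AE] by blast
  define K where "K = cball \<beta> r"
  have K: "compact K" "convex K" "K \<noteq> {}" "K \<subseteq> ball \<beta> \<rho>" "K \<subseteq> \<Phi>"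
    using r \<rho>(2) unfolding K_def by auto
  have cball_\<Phi>: "cball \<beta> r \<subseteq> \<Phi>"
    using K(5) unfolding K_def .
  \<comment> \<open>\<open>Ls n\<close> is about \<open>1 / sqrt (J n \<beta>)\<close>, so that \<open>Ls n * J n \<beta> \<le> sqrt (J n \<beta>)\<close>; the summand
     \<open>inverse (Suc n)\<close> keeps the denominator positive when \<open>J n \<beta> = 0\<close>.\<close>
  define Ls where "Ls n = inverse (sqrt (J n \<beta>) + inverse (real (Suc n)))" for n
  have J\<beta>: "0 \<le> J n \<beta>" for n
    using J_nonneg \<beta>_in by blast
  have denom: "0 < sqrt (J n \<beta>) + inverse (real (Suc n))" for n
    using J\<beta> by (intro add_nonneg_pos) auto
  then have Ls_pos: "0 < Ls n" for n
    unfolding Ls_def by simp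
  have sqrt_J: "(\<lambda>n. sqrt (J n \<beta>)) \<longlonglongrightarrow> 0"
    using tendsto_real_sqrt[OF J_tendsto] by simp
  have "(\<lambda>n. sqrt (J n \<beta>) + inverse (real (Suc n))) \<longlonglongrightarrow> 0"
    using tendsto_add[OF sqrt_J LIMSEQ_inverse_real_of_nat] by simp
  then have Ls_top: "filterlim Ls at_top sequentially"
    unfolding Ls_def using denom by (intro filterlim_inverse_at_top) auto
  have LsJ: "(\<lambda>n. Ls n * J n \<beta>) \<longlonglongrightarrow> 0"
  proof (rule tendsto_sandwich[OF _ _ tendsto_const sqrt_J])
    have "Ls n * J n \<beta> \<le> sqrt (J n \<beta>)" for n
    proof -
      have "J n \<beta> \<le> sqrt (J n \<beta>) * (sqrt (J n \<beta>) + inverse (real (Suc n)))"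
        using J\<beta>[of n] by (simp add: distrib_left)
      then show ?thesis
        unfolding Ls_def using denom[of n] by (simp add: field_simps)
    qed
    then show "\<forall>\<^sub>F n in sequentially. Ls n * J n \<beta> \<le> sqrt (J n \<beta>)"
      by simp
    show "\<forall>\<^sub>F n in sequentially. 0 \<le> Ls n * J n \<beta>"
      using Ls_pos J\<beta> by (simp add: less_imp_le)
  qed
  \<comment> \<open>For the finitely many \<open>n\<close> at which the horizon is too long for the gap \<open>\<eta>\<close>, the event is empty.\<close>
  define A where "A n = (if Ls n * J n \<beta> < \<eta> then E n \<inter> F n else {})" for n
  have A_sub: "\<omega> \<in> A n \<Longrightarrow> \<omega> \<in> E n \<and> \<omega> \<in> F n \<and> Ls n * J n \<beta> < \<eta>" for n \<omega>
    unfolding A_def by (auto split: if_splits)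
  have EF: "asymptotically_sure P (\<lambda>n. E n \<inter> F n)"
    using E(1) F(1) by (rule asymptotically_sure_Int)
  then have A_events: "A n \<in> events" for n
    unfolding A_def asymptotically_sure_def by simp
  have "\<forall>\<^sub>F n in sequentially. Ls n * J n \<beta> < \<eta>"
    using LsJ \<eta> by (rule order_tendstoD(2))
  then have ev: "\<forall>\<^sub>F n in sequentially. prob (E n \<inter> F n) = prob (A n)"
    by eventually_elim (simp add: A_def)
  have A_prob: "(\<lambda>n. prob (A n)) \<longlonglongrightarrow> 1"
    using EF unfolding asymptotically_sure_def by (intro Lim_transform_eventually[OF _ ev]) blast
  have problem: "penalty_problem K (\<lambda>x. M n x \<omega>) (J n)" if "\<omega> \<in> A n" for n \<omega>
  proof
    have c: "convex_on \<Phi> (\<lambda>x. M n x \<omega>)"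
      using A_sub[OF that] E(2) by blast
    have cont: "continuous_on K f" if "convex_on \<Phi> f" for f
    proof (rule continuous_on_subset[OF _ K(4)])
      show "continuous_on (ball \<beta> \<rho>) f"
        using convex_on_subset[OF that \<rho>(2)] by (intro convex_on_continuous) auto
    qed
    show "continuous_on K (\<lambda>x. M n x \<omega>)" "continuous_on K (J n)"
      using cont c J_convex by auto
    show "convex_on K (\<lambda>x. M n x \<omega>)" "convex_on K (J n)"
      using convex_on_subset c J_convex K by blast+
    show "strictly_convex_on K (\<lambda>x. M n x \<omega>) \<or> strictly_convex_on K (J n)"
      using strict[OF F(2)] A_sub[OF that] K(5) strictly_convex_on_subset by blast
  qed (fact K)+
  define b where "b n t \<omega> =
    (if \<omega> \<in> A n \<and> t \<le> Ls n then penalty_path K (\<lambda>x. M n x \<omega>) (J n) t else \<beta>)" for n t \<omega>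
  show ?thesis
  proof (rule that[of Ls A b])
    show "admissible P \<Phi> Ls A b"
      unfolding admissible_def valued_processes_def
    proof (intro conjI allI impI ballI A_events A_prob Ls_top less_imp_le[OF Ls_pos])
      fix n and t :: real assume "0 \<le> t"
      show "b n t \<in> borel_measurable P"
      proof (cases "t \<le> Ls n")
        case True
        have "{\<omega> \<in> space P. \<omega> \<in> A n} \<in> events"
          using A_events[of n] by measurable
        moreover have "(\<lambda>\<omega>. penalty_path K (\<lambda>x. M n x \<omega>) (J n) t)
            \<in> borel_measurable (restrict_space P {\<omega>. \<omega> \<in> A n})"
          using \<open>0 \<le> t\<close> K(1,5) problem M_measurable
          by (intro measurable_penalty_path measurable_restrict_space1) (auto simp: space_restrict_space)
        ultimately have "(\<lambda>\<omega>. if \<omega> \<in> A n then penalty_path K (\<lambda>x. M n x \<omega>) (J n) t else \<beta>) \<in> borel_measurable P"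
          by (subst measurable_If_restrict_space_iff) auto
        then show ?thesis
          using True unfolding b_def[abs_def] by simp
      next
        case False
        then have "b n t = (\<lambda>_. \<beta>)"
          unfolding b_def by (simp add: fun_eq_iff)
        then show ?thesis
          by simp
      qed
      show "b n t \<omega> \<in> \<Phi>" for \<omega>
        using penalty_problem.penalty_path_in[OF problem] \<open>0 \<le> t\<close> K(5) \<beta>_in unfolding b_def by auto
    qed
    fix n \<omega>
    show "convex_on \<Phi> (\<lambda>\<phi>. M n \<phi> \<omega>)"
      and "S n \<omega>" if "\<omega> \<in> A n"
      using A_sub[OF that] E(2) F(2) by blast+
    show "is_arg_min (\<lambda>\<phi>. penalized M J n \<phi> t \<omega>) (\<lambda>\<phi>. \<phi> \<in> \<Phi>) (b n t \<omega>)"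
      if t: "t \<in> {0..Ls n}" and \<omega>: "\<omega> \<in> A n" for t
    proof -
      interpret penalty_problem K "\<lambda>x. M n x \<omega>" "J n"
        using problem \<omega> .
      have b: "b n t \<omega> = penalty_path K (\<lambda>x. M n x \<omega>) (J n) t"
        unfolding b_def using t \<omega> by simp
      show ?thesis
      proof (rule minimizer_on_cball_is_arg_min[where r = r and \<beta> = \<beta> and \<eta> = "\<eta> - Ls n * J n \<beta>"])
        show "convex_on \<Phi> (\<lambda>\<phi>. penalized M J n \<phi> t \<omega>)"
          unfolding penalized_def using t E(2) A_sub[OF \<omega>] J_convex
          by (intro convex_on_add convex_on_cmul) auto
        show "0 < \<eta> - Ls n * J n \<beta>"
          using A_sub[OF \<omega>] by simp
        show "cball \<beta> r \<subseteq> \<Phi>"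
          by (rule cball_\<Phi>)
        show "penalized M J n \<beta> t \<omega> + (\<eta> - Ls n * J n \<beta>) \<le> penalized M J n s t \<omega>"
          if "s \<in> sphere \<beta> r" for s
        proof -
          have "s \<in> \<Phi>"
            using that cball_\<Phi> by auto
          then have "0 \<le> t * J n s"
            using t J_nonneg by simp
          moreover have "t * J n \<beta> \<le> Ls n * J n \<beta>"
            using t J\<beta> by (intro mult_right_mono) auto
          moreover have "M n \<beta> \<omega> + \<eta> \<le> M n s \<omega>"
            using E(3) A_sub[OF \<omega>] that by blast
          ultimately show ?thesis
            unfolding penalized_def by linarith
        qed
        show "b n t \<omega> \<in> cball \<beta> r"
          using b penalty_path_in t unfolding K_def by simp
        show "penalized M J n (b n t \<omega>) t \<omega> \<le> penalized M J n y t \<omega>" if "y \<in> cball \<beta> r" for y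
          using b penalty_path_min t that unfolding penalized_def K_def by simp
      qed (fact r(1))
    qed
    show "continuous_on {0..Ls n} (\<lambda>t. b n t \<omega>)"
    proof (cases "\<omega> \<in> A n")
      case True
      then have "continuous_on {0..Ls n} (penalty_path K (\<lambda>x. M n x \<omega>) (J n))"
        using penalty_problem.continuous_on_penalty_path[OF problem] continuous_on_subset by fastforce
      then show ?thesis
        unfolding b_def using True by (subst continuous_on_cong[OF refl]) auto
    qed (simp add: b_def)
    have "continuous_on {Ls n<..} (\<lambda>_. \<beta>)"
      by simp
    then show "continuous_on {Ls n<..} (\<lambda>t. b n t \<omega>)"
      unfolding b_def by (subst continuous_on_cong[OF refl]) auto
  qed
qed

end

theorem theorem5:
  fixes P :: "'w measure"
    and \<Phi> V :: "'a::euclidean_space set"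
    and M :: "nat \<Rightarrow> 'a \<Rightarrow> 'w \<Rightarrow> real"
    and J :: "nat \<Rightarrow> 'a \<Rightarrow> real"
    and \<Delta> :: "'a \<Rightarrow> real"
    and \<beta> :: 'a
  assumes "prob_space P"
    and "convex \<Phi>"
    and "\<And>n \<phi>. \<phi> \<in> \<Phi> \<Longrightarrow> M n \<phi> \<in> borel_measurable P"
    and "\<And>n. AE \<omega> in P. convex_on \<Phi> (\<lambda>\<phi>. M n \<phi> \<omega>)"
    and "\<beta> \<in> \<Phi>"
    and "V \<subseteq> \<Phi>"
    and "\<beta> \<in> interior V"
    and "strictly_convex_on V \<Delta>"
    and "\<And>\<phi>. \<phi> \<in> V \<Longrightarrow> tendsto_zero_prob P (\<lambda>n \<omega>. ereal (M n \<phi> \<omega> - \<Delta> \<phi>))"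
    and "\<And>\<phi>. \<phi> \<in> V \<Longrightarrow> \<Delta> \<beta> \<le> \<Delta> \<phi>"
    and "\<And>n \<phi>. \<phi> \<in> \<Phi> \<Longrightarrow> 0 \<le> J n \<phi>"
    and "(\<lambda>n. J n \<beta>) \<longlonglongrightarrow> 0"
  shows
    "(\<forall>L b. 0 \<le> L \<and> valued_processes P \<Phi> b \<and> near_minimizing P M J \<beta> L b \<longrightarrow>
        tendsto_zero_outer_prob P (sup_dist \<beta> L b))
     \<and>
     ((\<forall>n. strictly_convex_on \<Phi> (J n)) \<longrightarrow>
        (let good = (\<lambda>Ls A b. admissible P \<Phi> Ls A b \<and>
           (\<forall>n. \<forall>t\<in>{0..Ls n}. \<forall>\<omega>\<in>A n.
              is_arg_min (\<lambda>\<phi>. penalized M J n \<phi> t \<omega>) (\<lambda>\<phi>. \<phi> \<in> \<Phi>) (b n t \<omega>) \<and>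
              (t > 0 \<longrightarrow>
                is_unique_arg_min (\<lambda>\<phi>. penalized M J n \<phi> t \<omega>) (\<lambda>\<phi>. \<phi> \<in> \<Phi>) (b n t \<omega>))) \<and>
           (\<forall>n. \<forall>\<omega>\<in>space P.
              continuous_on {0<..Ls n} (\<lambda>t. b n t \<omega>) \<and>
              continuous_on {Ls n<..} (\<lambda>t. b n t \<omega>)))
         in (\<exists>Ls A b. good Ls A b) \<and>
            (\<forall>Ls A b. good Ls A b \<longrightarrow>
               (\<forall>L>0. near_minimizing P M J \<beta> L b \<and> tendsto_zero_prob P (sup_dist \<beta> L b)))))
     \<and>
     ((\<forall>n. AE \<omega> in P. strictly_convex_on \<Phi> (\<lambda>\<phi>. M n \<phi> \<omega>)) \<and> (\<forall>n. convex_on \<Phi> (J n)) \<longrightarrow>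
        (let good = (\<lambda>Ls A b. admissible P \<Phi> Ls A b \<and>
           (\<forall>n. \<forall>t\<in>{0..Ls n}. \<forall>\<omega>\<in>A n.
              is_unique_arg_min (\<lambda>\<phi>. penalized M J n \<phi> t \<omega>) (\<lambda>\<phi>. \<phi> \<in> \<Phi>) (b n t \<omega>)) \<and>
           (\<forall>n. \<forall>\<omega>\<in>space P.
              continuous_on {0..Ls n} (\<lambda>t. b n t \<omega>) \<and>
              continuous_on {Ls n<..} (\<lambda>t. b n t \<omega>)))
         in (\<exists>Ls A b. good Ls A b) \<and>
            (\<forall>Ls A b. good Ls A b \<longrightarrow>
               (\<forall>L>0. near_minimizing P M J \<beta> L b \<and> tendsto_zero_prob P (sup_dist \<beta> L b)))))"
proof -
  interpret convex_limit_problem P \<Phi> V M J \<Delta> \<beta>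
    using assms by (intro convex_limit_problem.intro convex_limit_problem_axioms.intro)
  have exists_and_all: "let good = G in (\<exists>Ls A b. good Ls A b) \<and> (\<forall>Ls A b. good Ls A b \<longrightarrow> Q b)"
    if "G Ls A b" "\<And>Ls A b. G Ls A b \<Longrightarrow> Q b" for G Ls A b Q
    using that by (auto simp: Let_def)
  have convergence: "\<forall>L>0. near_minimizing P M J \<beta> L b \<and> tendsto_zero_prob P (sup_dist \<beta> L b)"
    if "admissible P \<Phi> Ls A b"
      "\<And>n t \<omega>. t \<in> {0..Ls n} \<Longrightarrow> \<omega> \<in> A n \<Longrightarrow>
        is_arg_min (\<lambda>\<phi>. penalized M J n \<phi> t \<omega>) (\<lambda>\<phi>. \<phi> \<in> \<Phi>) (b n t \<omega>)"
      "\<And>n \<omega>. \<omega> \<in> space P \<Longrightarrow> continuous_on {0<..Ls n} (\<lambda>t. b n t \<omega>)"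
      "\<And>n \<omega>. \<omega> \<in> space P \<Longrightarrow> continuous_on {Ls n<..} (\<lambda>t. b n t \<omega>)"
    for Ls A b
    using minimizers_converge[OF that(1) _ that(2-4)] by blast
  have unique: "is_unique_arg_min (\<lambda>\<phi>. penalized M J n \<phi> t \<omega>) (\<lambda>\<phi>. \<phi> \<in> \<Phi>) x"
    if "is_arg_min (\<lambda>\<phi>. penalized M J n \<phi> t \<omega>) (\<lambda>\<phi>. \<phi> \<in> \<Phi>) x"
      "convex_on \<Phi> (\<lambda>\<phi>. M n \<phi> \<omega>)" "convex_on \<Phi> (J n)" "0 \<le> t"
      "strictly_convex_on \<Phi> (\<lambda>\<phi>. M n \<phi> \<omega>) \<or> 0 < t \<and> strictly_convex_on \<Phi> (J n)"
    for n t \<omega> x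
    using strictly_convex_on_is_unique_arg_min[OF strictly_convex_on_add_scaled[OF convex_\<Phi> that(2-5)] convex_\<Phi>]
      that(1) unfolding penalized_def .
  show ?thesis
  proof (intro conjI impI, goal_cases)
    case 1
    show ?case
      using near_minimizers_converge by blast
  next
    case 2
    then have J_convex: "convex_on \<Phi> (J n)" for n
      using strictly_convex_on_imp_convex_on convex_\<Phi> by blast
    show ?case
    proof (rule minimizers_exist[OF J_convex, of "\<lambda>_ _. True"])
      fix Ls A b
      assume ex: "admissible P \<Phi> Ls A b"
        "\<And>n \<omega>. \<omega> \<in> A n \<Longrightarrow> convex_on \<Phi> (\<lambda>\<phi>. M n \<phi> \<omega>)"
        "\<And>n \<omega>. \<omega> \<in> A n \<Longrightarrow> True"
        "\<And>n t \<omega>. t \<in> {0..Ls n} \<Longrightarrow> \<omega> \<in> A n \<Longrightarrow>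
            is_arg_min (\<lambda>\<phi>. penalized M J n \<phi> t \<omega>) (\<lambda>\<phi>. \<phi> \<in> \<Phi>) (b n t \<omega>)"
        "\<And>n \<omega>. continuous_on {0..Ls n} (\<lambda>t. b n t \<omega>)"
        "\<And>n \<omega>. continuous_on {Ls n<..} (\<lambda>t. b n t \<omega>)"
      have "is_unique_arg_min (\<lambda>\<phi>. penalized M J n \<phi> t \<omega>) (\<lambda>\<phi>. \<phi> \<in> \<Phi>) (b n t \<omega>)"
        if "t \<in> {0..Ls n}" "\<omega> \<in> A n" "0 < t" for n t \<omega>
        using that ex(2,4) 2 J_convex by (intro unique) auto
      moreover have "continuous_on {0<..Ls n} (\<lambda>t. b n t \<omega>)" for n \<omega>
        using ex(5) by (rule continuous_on_subset) auto
      ultimately show ?thesis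
      proof (intro exists_and_all[of _ Ls A b], goal_cases)
        case 1
        then show ?case
          using ex(1,4,6) by blast
      next
        case (2 Ls A b)
        then show ?case
          by (intro convergence[of Ls A b]) blast+
      qed
    qed (use 2 in auto)
  next
    case 3
    then have J_convex: "convex_on \<Phi> (J n)"
      and strict: "AE \<omega> in P. strictly_convex_on \<Phi> (\<lambda>\<phi>. M n \<phi> \<omega>)" for n
      by blast+
    show ?case
    proof (rule minimizers_exist[OF J_convex strict disjI1])
      fix Ls A b
      assume ex: "admissible P \<Phi> Ls A b"
        "\<And>n \<omega>. \<omega> \<in> A n \<Longrightarrow> convex_on \<Phi> (\<lambda>\<phi>. M n \<phi> \<omega>)"
        "\<And>n \<omega>. \<omega> \<in> A n \<Longrightarrow> strictly_convex_on \<Phi> (\<lambda>\<phi>. M n \<phi> \<omega>)"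
        "\<And>n t \<omega>. t \<in> {0..Ls n} \<Longrightarrow> \<omega> \<in> A n \<Longrightarrow>
            is_arg_min (\<lambda>\<phi>. penalized M J n \<phi> t \<omega>) (\<lambda>\<phi>. \<phi> \<in> \<Phi>) (b n t \<omega>)"
        "\<And>n \<omega>. continuous_on {0..Ls n} (\<lambda>t. b n t \<omega>)"
        "\<And>n \<omega>. continuous_on {Ls n<..} (\<lambda>t. b n t \<omega>)"
      have "is_unique_arg_min (\<lambda>\<phi>. penalized M J n \<phi> t \<omega>) (\<lambda>\<phi>. \<phi> \<in> \<Phi>) (b n t \<omega>)"
        if "t \<in> {0..Ls n}" "\<omega> \<in> A n" for n t \<omega>
        using that ex(2-4) J_convex by (intro unique) auto
      then show ?thesis
      proof (intro exists_and_all[of _ Ls A b], goal_cases)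
        case 1
        then show ?case
          using ex(1,5,6) by blast
      next
        case (2 Ls A b)
        then have min: "is_unique_arg_min (\<lambda>\<phi>. penalized M J n \<phi> t \<omega>) (\<lambda>\<phi>. \<phi> \<in> \<Phi>) (b n t \<omega>)"
          if "t \<in> {0..Ls n}" "\<omega> \<in> A n" for n t \<omega>
          using that by blast
        show ?case
        proof (rule convergence[of Ls A b])
          show "admissible P \<Phi> Ls A b"
            using 2 by blast
          show "is_arg_min (\<lambda>\<phi>. penalized M J n \<phi> t \<omega>) (\<lambda>\<phi>. \<phi> \<in> \<Phi>) (b n t \<omega>)"
            if "t \<in> {0..Ls n}" "\<omega> \<in> A n" for n t \<omega>
            using min[OF that] unfolding is_unique_arg_min_def by blast
          fix n \<omega> assume \<omega>: "\<omega> \<in> space P"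
          then have "continuous_on {0..Ls n} (\<lambda>t. b n t \<omega>)"
            using 2 by blast
          then show "continuous_on {0<..Ls n} (\<lambda>t. b n t \<omega>)"
            by (rule continuous_on_subset) auto
          show "continuous_on {Ls n<..} (\<lambda>t. b n t \<omega>)"
            using 2 \<omega> by blast
        qed
      qed
    qed assumption
  qed
qed

end
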